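(* Let $X(z)=\xi_\tau(6+z)$ be the Ramanujan-de Bruijn function, and for each integer $s\ge 0$ let $$\chi(s)=2\int_0^1 L(i\omega)\,\omega^5\,\frac{(\ln\omega)^{2s}}{(2s)!}\,d\omega.$$ Then for all $z\in\mathbb{C}$, $$X(z)=\sum_{s=0}^\infty\chi(s)z^{2s}.$$
   Context: For $\Im(x)>0$, $L(x)=q\prod_{n=1}^\infty(1-q^n)^{24}=\sum_{m=1}^\infty\tau(m)q^m$ with $q=e^{2\pi i x}$; this defines the Ramanujan function $\tau(m)$. The Ramanujan zeta function is $H_\tau(x)=\sum_{\ell=1}^\infty \tau(\ell)\ell^{-x}$ for $\Re(x)>13/2$, and $H_\tau$ also denotes its analytic continuation to $\mathbb{C}$. The Ramanujan-Rankin function $\xi_\tau(x)=(2\pi)^{-x}\Gamma(x)H_\tau(x)$ extends to an entire function of $x\in\mathbb{C}$ (denoted by the same symbol). *)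

theory Defs
  imports "HOL-Complex_Analysis.Complex_Analysis"
begin

definition Delta_q :: "complex \<Rightarrow> complex" where
  "Delta_q q = q * (\<Prod>n. (1 - q ^ Suc n) ^ 24)"

definition L :: "complex \<Rightarrow> complex" where
  "L x = Delta_q (exp (2 * of_real pi * \<i> * x))"

definition ramanujan_tau :: "nat \<Rightarrow> complex" where
  "ramanujan_tau m = fps_nth (fps_expansion Delta_q 0) m"

lemma Delta_q_holomorphic: "Delta_q holomorphic_on ball 0 1"
proof -
  have "(\<lambda>q::complex. \<Prod>n. (1 - q ^ Suc n) ^ 24) holomorphic_on ball 0 1"
  proof (rule holomorphic_uniform_sequence)
    show "(\<lambda>q::complex. \<Prod>k<n. (1 - q ^ Suc k) ^ 24) holomorphic_on ball 0 1" for n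
      by (intro holomorphic_intros)
  next
    fix x :: complex assume x: "x \<in> ball 0 1"
    define d where "d = (1 - norm x) / 2"
    define r where "r = norm x + d"
    have d: "d > 0" and r: "0 \<le> r" "r < 1" using x by (auto simp: d_def r_def field_simps add_nonneg_pos)
    have nr: "norm y \<le> r" if "y \<in> cball x d" for y
    proof -
      have "norm y \<le> norm x + norm (y - x)" by (metis norm_triangle_sub)
      thus ?thesis using that by (simp add: r_def dist_norm norm_minus_commute)
    qed
    have pw: "norm (y ^ Suc n) \<le> r ^ Suc n" if "y \<in> cball x d" for y n
      using nr[OF that] by (metis norm_ge_zero norm_power power_mono)
    have uc: "uniformly_convergent_on (cball x d) (\<lambda>N y. \<Prod>n<N. (1 - y ^ Suc n))"
    proof (rule uniformly_convergent_on_prod')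
      show "uniformly_convergent_on (cball x d) (\<lambda>N y. \<Sum>n<N. norm (1 - y ^ Suc n - 1))"
      proof (rule Weierstrass_m_test')
        show "summable (\<lambda>n. r ^ Suc n)"
          using r by (subst summable_Suc_iff) (simp add: summable_geometric)
      qed (use pw in auto)
    qed (auto intro!: continuous_intros)
    have conv: "convergent_prod (\<lambda>n. 1 - y ^ Suc n)" if "norm y < 1" for y :: complex
    proof (rule abs_convergent_prod_imp_convergent_prod)
      have "summable (\<lambda>n. norm y ^ Suc n)"
        using that by (subst summable_Suc_iff) (simp add: summable_geometric)
      thus "abs_convergent_prod (\<lambda>n. 1 - y ^ Suc n)"
        by (simp add: abs_convergent_prod_conv_summable norm_power norm_mult)
    qed
    have pd: "(\<lambda>n. (1 - y ^ Suc n) ^ 24) has_prod (\<Prod>n. 1 - y ^ Suc n) ^ 24" if "norm y < 1" for y :: complex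
      using convergent_prod_has_prod[OF conv[OF that]] by (rule has_prod_power)
    have "uniform_limit (cball x d) (\<lambda>N y. \<Prod>n<N. (1 - y ^ Suc n)) (\<lambda>y. \<Prod>n. 1 - y ^ Suc n) sequentially"
    proof -
      obtain l where l: "uniform_limit (cball x d) (\<lambda>N y. \<Prod>n<N. (1 - y ^ Suc n)) l sequentially"
        using uc by (auto simp: uniformly_convergent_on_def)
      have "l y = (\<Prod>n. 1 - y ^ Suc n)" if y: "y \<in> cball x d" for y
      proof -
        have "norm y < 1" using nr[OF y] r by simp
        hence "(\<lambda>N. \<Prod>n\<le>N. (1 - y ^ Suc n)) \<longlonglongrightarrow> (\<Prod>n. 1 - y ^ Suc n)"
          using conv convergent_prod_LIMSEQ by blast
        hence "(\<lambda>N. \<Prod>n<N. (1 - y ^ Suc n)) \<longlonglongrightarrow> (\<Prod>n. 1 - y ^ Suc n)"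
          using LIMSEQ_lessThan_iff_atMost by blast
        thus ?thesis using tendsto_uniform_limitI[OF l y] LIMSEQ_unique by blast
      qed
      thus ?thesis using l by (subst uniform_limit_cong'[where g = "\<lambda>N y. \<Prod>n<N. (1 - y ^ Suc n)" and i = l]) auto
    qed
    note ul = this
    have cont: "continuous_on (cball x d) (\<lambda>y. \<Prod>n. 1 - y ^ Suc n)"
      by (rule uniform_limit_theorem[OF _ ul]) (auto intro!: always_eventually continuous_intros)
    have bd: "bounded ((\<lambda>y. \<Prod>n. 1 - y ^ Suc n) ` cball x d)"
      by (intro compact_imp_bounded compact_continuous_image cont) auto
    have "uniform_limit (cball x d) (\<lambda>N y. (\<Prod>n<N. (1 - y ^ Suc n)) ^ k)
            (\<lambda>y. (\<Prod>n. 1 - y ^ Suc n) ^ k) sequentially" for k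
    proof (induction k)
      case (Suc k)
      have "bounded ((\<lambda>y. (\<Prod>n. 1 - y ^ Suc n) ^ k) ` cball x d)"
        by (intro compact_imp_bounded compact_continuous_image continuous_intros cont) auto
      from uniform_lim_mult[OF ul Suc bd this] show ?case by simp
    qed (simp add: uniform_limit_const)
    from this[of 24] have "uniform_limit (cball x d) (\<lambda>N y. \<Prod>n<N. (1 - y ^ Suc n) ^ 24)
            (\<lambda>y. (\<Prod>n. 1 - y ^ Suc n) ^ 24) sequentially" by (simp add: prod_power_distrib)
    moreover have "(\<Prod>n. (1 - y ^ Suc n) ^ 24) = (\<Prod>n. 1 - y ^ Suc n) ^ 24" if "y \<in> cball x d" for y
      using has_prod_unique[OF pd] nr[OF that] r by simp
    ultimately have "uniform_limit (cball x d) (\<lambda>N y. \<Prod>n<N. (1 - y ^ Suc n) ^ 24)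
            (\<lambda>y. \<Prod>n. (1 - y ^ Suc n) ^ 24) sequentially"
      by (subst uniform_limit_cong'[where g = "\<lambda>N y. \<Prod>n<N. (1 - y ^ Suc n) ^ 24"
            and i = "\<lambda>y. (\<Prod>n. 1 - y ^ Suc n) ^ 24"]) auto
    moreover have "cball x d \<subseteq> ball 0 1" using nr r by force
    ultimately show "\<exists>d>0. cball x d \<subseteq> ball 0 1 \<and> uniform_limit (cball x d)
            (\<lambda>N y. \<Prod>n<N. (1 - y ^ Suc n) ^ 24) (\<lambda>y. \<Prod>n. (1 - y ^ Suc n) ^ 24) sequentially"
      using d by blast
  qed auto
  thus ?thesis unfolding Delta_q_def by (intro holomorphic_intros)
qed

lemma ramanujan_tau_sums:
  assumes "Im x > 0"
  shows "(\<lambda>m. ramanujan_tau m * exp (2 * of_real pi * \<i> * x) ^ m) sums L x"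
proof -
  have "exp (2 * of_real pi * \<i> * x) \<in> ball 0 1"
    using assms by simp
  from holomorphic_power_series[OF Delta_q_holomorphic this] show ?thesis
    by (simp add: L_def ramanujan_tau_def fps_expansion_def)
qed

lemma ramanujan_tau_0: "ramanujan_tau 0 = 0"
  by (simp add: ramanujan_tau_def fps_expansion_def Delta_q_def)

text \<open>The entire function continuing the Dirichlet series; unique by the identity theorem.\<close>
definition H_tau :: "complex \<Rightarrow> complex" where
  "H_tau = (THE h. h holomorphic_on UNIV \<and>
     (\<forall>x. Re x > 13/2 \<longrightarrow>
        (\<lambda>l. ramanujan_tau (Suc l) * of_nat (Suc l) powr (- x)) sums h x))"

text \<open>\<open>Gamma\<close> is \<open>0\<close> at its poles by convention, so the product on the right does not by itself
  give the value of the extension there; \<open>remove_sings\<close> takes the limit.\<close>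
definition xi_tau :: "complex \<Rightarrow> complex" where
  "xi_tau = remove_sings (\<lambda>x. of_real (2 * pi) powr (- x) * Gamma x * H_tau x)"

definition X :: "complex \<Rightarrow> complex" where
  "X z = xi_tau (6 + z)"

definition chi :: "nat \<Rightarrow> complex" where
  "chi s = 2 * (LINT w:{0..1}|lborel.
     L (\<i> * of_real w) * of_real (w ^ 5 * (ln w ^ (2 * s) / fact (2 * s))))"

end

theory Submission
  imports Defs "HOL-Real_Asymp.Real_Asymp"
begin

text \<open>
  Let \<open>\<Xi>(z)\<close> be the integral of \<open>L(it) t^5 (t^z + t^(-z))\<close> over \<open>(0,1]\<close>. Expanding
  \<open>t^z + t^(-z) = 2 cosh (z ln t)\<close> gives \<open>\<Xi>(z) = \<Sum>s. \<chi>(s) z^(2s)\<close> by dominated convergence, so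
  \<open>\<Xi>\<close> is entire. The modular relation \<open>L(i/t) = t^12 L(it)\<close> unfolds \<open>\<Xi>(x - 6)\<close> to the Mellin
  transform of \<open>L(it)\<close> over \<open>(0,\<infinity>)\<close>, which is \<open>(2\<pi>)^(-x) \<Gamma>(x) H\<^sub>\<tau>(x)\<close> for \<open>Re x > 13/2\<close>; hence
  \<open>H\<^sub>\<tau>(x) = (2\<pi>)^x \<Xi>(x - 6) / \<Gamma>(x)\<close> everywhere.

  The modular relation is integrated from the transformation law of the logarithmic derivative of
  \<open>L\<close> (the Eisenstein series of weight two). Absolute convergence of the Dirichlet series up to the
  line \<open>13/2\<close> follows from Hecke's bound \<open>|L(z)| = O(Im(z)^(-6))\<close>: Parseval's formula on
  \<open>Im z = 1/N\<close> bounds \<open>\<Sum>n<N. |\<tau>(n)|^2\<close> by a multiple of \<open>N^12\<close>, and Cauchy-Schwarz then bounds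
  \<open>\<Sum>n<N. |\<tau>(n)|\<close> by a multiple of \<open>N^(13/2)\<close>.
\<close>

section \<open>The Eisenstein series of weight two on the imaginary axis\<close>

text \<open>Differentiating \<open>rGamma w * rGamma (1 - w) = sin (pi * w) / pi\<close> gives
  \<open>Digamma (1 - w) - Digamma w = pi * cot (pi * w)\<close> away from the integers. One further
  derivative gives the claim.\<close>

lemma Polygamma_1_reflection:
  fixes z :: complex
  assumes "z \<notin> \<int>"
  shows "Polygamma 1 z + Polygamma 1 (1 - z) = of_real pi ^ 2 / sin (of_real pi * z) ^ 2"
proof -
  have nz: "w \<notin> \<int>\<^sub>\<le>\<^sub>0" "1 - w \<notin> \<int>\<^sub>\<le>\<^sub>0" "sin (of_real pi * w) \<noteq> 0" if "w \<notin> \<int>" for w :: complex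
  proof -
    show "w \<notin> \<int>\<^sub>\<le>\<^sub>0" using that nonpos_Ints_Int by blast
    have "1 - w \<notin> \<int>" using that by (metis Ints_1 Ints_diff diff_diff_eq2 add_diff_cancel_left')
    thus "1 - w \<notin> \<int>\<^sub>\<le>\<^sub>0" using nonpos_Ints_Int by blast
    show "sin (of_real pi * w) \<noteq> 0"
    proof
      assume "sin (of_real pi * w) = 0"
      then obtain n :: int where "of_real pi * w = of_real (of_int n * pi)"
        by (auto simp: sin_eq_0)
      hence "w = of_int n" by (simp add: field_simps)
      with that show False by simp
    qed
  qed
  have dig: "Digamma (1 - w) - Digamma w = of_real pi * cos (of_real pi * w) / sin (of_real pi * w)"
    if "w \<notin> \<int>" for w :: complex
  proof -
    have "((\<lambda>w::complex. rGamma w * rGamma (1 - w)) has_field_derivative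
            rGamma w * rGamma (1 - w) * (Digamma (1 - w) - Digamma w)) (at w)"
      using nz[OF that] by (auto intro!: derivative_eq_intros simp: algebra_simps)
    moreover have "(\<lambda>w::complex. rGamma w * rGamma (1 - w)) = (\<lambda>w. sin (of_real pi * w) / of_real pi)"
      by (simp add: rGamma_reflection_complex)
    ultimately have "((\<lambda>w. sin (of_real pi * w) / of_real pi) has_field_derivative
            sin (of_real pi * w) / of_real pi * (Digamma (1 - w) - Digamma w)) (at w)"
      by (simp add: rGamma_reflection_complex)
    moreover have "((\<lambda>w. sin (of_real pi * w) / of_real pi) has_field_derivative cos (of_real pi * w)) (at w)"
      by (auto intro!: derivative_eq_intros)
    ultimately have "sin (of_real pi * w) / of_real pi * (Digamma (1 - w) - Digamma w) = cos (of_real pi * w)"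
      using DERIV_unique by blast
    thus ?thesis using nz[OF that] by (simp add: field_simps)
  qed
  have "((\<lambda>w. Digamma (1 - w) - Digamma w) has_field_derivative
           - (Polygamma 1 z + Polygamma 1 (1 - z))) (at z)"
    using nz[OF assms] by (auto intro!: derivative_eq_intros)
  moreover have "((\<lambda>w. Digamma (1 - w) - Digamma w) has_field_derivative
           - (of_real pi ^ 2 / sin (of_real pi * z) ^ 2)) (at z)"
  proof (rule has_field_derivative_transform_within_open)
    show "((\<lambda>w. of_real pi * cos (of_real pi * w) / sin (of_real pi * w)) has_field_derivative
           - (of_real pi ^ 2 / sin (of_real pi * z) ^ 2)) (at z)"
    proof -
      have "complex_of_real pi * (of_real pi * (cos (z * of_real pi) * cos (z * of_real pi))) +
              of_real pi * (of_real pi * (sin (z * of_real pi) * sin (z * of_real pi))) =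
            of_real pi * (of_real pi * (cos (z * of_real pi) ^ 2 + sin (z * of_real pi) ^ 2))"
        by (simp only: power2_eq_square distrib_left)
      also have "\<dots> = of_real pi * of_real pi" by simp
      finally have trig: "complex_of_real pi * (of_real pi * (cos (z * of_real pi) * cos (z * of_real pi))) +
              of_real pi * (of_real pi * (sin (z * of_real pi) * sin (z * of_real pi))) =
            of_real pi * of_real pi" .
      show ?thesis using nz[OF assms]
        by (auto intro!: derivative_eq_intros simp: power2_eq_square divide_simps)
           (simp add: algebra_simps trig)
    qed
    show "open (- \<int> :: complex set)" by (simp add: open_Compl)
  qed (use assms dig in auto)
  ultimately show ?thesis using DERIV_unique by (metis neg_equal_iff_equal)
qed

text \<open>The reflection formula at \<open>z = \<i> x\<close> sums
  \<open>1 / (m + \<i> x)^2\<close> over all integers m. The terms m and -m are conjugate, so each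
  pair is twice a real part; the term m = 0 is \<open>- 1 / x\<^sup>2\<close> and moves to the
  right-hand side.\<close>

lemma sums_inverse_sinh_squared:
  fixes x :: real
  assumes x: "x > 0"
  shows "(\<lambda>m. (real (Suc m) ^ 2 - x\<^sup>2) / (real (Suc m) ^ 2 + x\<^sup>2)\<^sup>2) sums
           ((1 / x\<^sup>2 - pi\<^sup>2 / sinh (pi * x) ^ 2) / 2)"
proof -
  define z :: complex where "z = of_real x * \<i>"
  have zI: "z \<notin> \<int>" using x by (auto simp: z_def elim!: Ints_cases simp: complex_eq_iff)
  have "z \<noteq> 0" "1 - z \<noteq> 0" using zI by auto
  note P = Polygamma_LIMSEQ[OF this(1), of 1] Polygamma_LIMSEQ[OF this(2), of 1]
  have "(\<lambda>k. inverse ((z + of_nat (Suc k)) ^ 2)) sums (Polygamma 1 z - inverse (z ^ 2))"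
    using P(1) by (subst sums_Suc_iff) (simp add: power2_eq_square)
  moreover have "(\<lambda>k. inverse ((1 - z + of_nat k) ^ 2)) sums Polygamma 1 (1 - z)"
    using P(2) by (simp add: power2_eq_square)
  ultimately have "(\<lambda>k. inverse ((z + of_nat (Suc k)) ^ 2) + inverse ((1 - z + of_nat k) ^ 2)) sums
          (Polygamma 1 z - inverse (z ^ 2) + Polygamma 1 (1 - z))"
    by (rule sums_add)
  also have "Polygamma 1 z - inverse (z ^ 2) + Polygamma 1 (1 - z) =
          of_real pi ^ 2 / sin (of_real pi * z) ^ 2 - inverse (z ^ 2)"
    by (simp add: Polygamma_1_reflection[OF zI, symmetric])
  finally have "(\<lambda>k. inverse ((z + of_nat (Suc k)) ^ 2) + inverse ((1 - z + of_nat k) ^ 2)) sums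
          (of_real pi ^ 2 / sin (of_real pi * z) ^ 2 - inverse (z ^ 2))" .
  moreover have "inverse ((z + of_nat (Suc k)) ^ 2) + inverse ((1 - z + of_nat k) ^ 2)
        = of_real (2 * ((real (Suc k) ^ 2 - x\<^sup>2) / (real (Suc k) ^ 2 + x\<^sup>2)\<^sup>2))" for k
  proof -
    define N where "N = real (Suc k)"
    have N: "N > 0" by (simp add: N_def)
    have 1: "z + of_nat (Suc k) = of_real N + \<i> * of_real x"
            "1 - z + of_nat k = of_real N - \<i> * of_real x"
      by (simp_all add: z_def N_def)
    have nz: "of_real N + \<i> * of_real x \<noteq> 0" "of_real N - \<i> * of_real x \<noteq> 0"
      using N by (auto simp: complex_eq_iff)
    have pr: "(of_real N + \<i> * of_real x) * (of_real N - \<i> * of_real x) = of_real (N\<^sup>2 + x\<^sup>2)"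
      by (simp add: algebra_simps power2_eq_square)
    have "inverse ((of_real N + \<i> * of_real x) ^ 2) + inverse ((of_real N - \<i> * of_real x) ^ 2)
        = ((of_real N - \<i> * of_real x)^2 + (of_real N + \<i> * of_real x)^2) /
          ((of_real N + \<i> * of_real x) * (of_real N - \<i> * of_real x)) ^ 2"
    proof -
      have "inverse (a ^ 2) + inverse (b ^ 2) = (b ^ 2 + a ^ 2) / (a * b) ^ 2"
        if "a \<noteq> 0" "b \<noteq> 0" for a b :: complex
        using that by (simp add: field_simps power_mult_distrib)
      from this[OF nz] show ?thesis .
    qed
    also have "\<dots> = of_real (2 * ((N ^ 2 - x\<^sup>2) / (N ^ 2 + x\<^sup>2)\<^sup>2))"
      unfolding pr by (simp add: power2_eq_square algebra_simps)
    finally show ?thesis unfolding 1 N_def .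
  qed
  moreover have "of_real pi ^ 2 / sin (of_real pi * z) ^ 2 - inverse (z ^ 2) =
       of_real (1 / x\<^sup>2 - pi\<^sup>2 / sinh (pi * x) ^ 2)"
  proof -
    have "sin (of_real pi * z) = \<i> * of_real (sinh (pi * x))"
      by (simp add: z_def sin_conv_sinh) (simp add: sinh_field_def exp_of_real[symmetric] field_simps)
    thus ?thesis by (simp add: z_def power_mult_distrib field_simps)
  qed
  ultimately have *: "(\<lambda>k. 2 * ((real (Suc k) ^ 2 - x\<^sup>2) / (real (Suc k) ^ 2 + x\<^sup>2)\<^sup>2)) sums
      (1 / x\<^sup>2 - pi\<^sup>2 / sinh (pi * x) ^ 2)"
    by (simp only: sums_of_real_iff)
  have "f sums (a / 2)" if "(\<lambda>k. 2 * f k) sums a" for f :: "nat \<Rightarrow> real" and a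
    using sums_divide[OF that, of 2] by simp
  from this[OF *] show ?thesis .
qed

text \<open>Integral test with the antiderivative \<open>arctan (t * y / M) / y\<close>: by
  monotonicity the n-th term lies between its increments over [n+1, n+2] and [n, n+1], and both
  telescope. As M grows the bounds close in on \<open>pi / (2 * y)\<close>, the amount by which the
  two orders of summation of the Eisenstein series differ.\<close>

lemma arctan_bounds_rational_series:
  fixes M y :: real
  assumes M: "M > 0" and y: "y > 0"
  shows "summable (\<lambda>n. M / (M\<^sup>2 + (real (Suc n) * y)\<^sup>2))"
    and "(\<Sum>n. M / (M\<^sup>2 + (real (Suc n) * y)\<^sup>2)) \<le> pi / (2 * y)"
    and "(\<Sum>n. M / (M\<^sup>2 + (real (Suc n) * y)\<^sup>2)) \<ge> pi / (2 * y) - arctan (y / M) / y"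
proof -
  define g where "g n = arctan (real n * y / M)" for n
  define f where "f n = M / (M\<^sup>2 + (real (Suc n) * y)\<^sup>2)" for n
  have mvt: "\<exists>t. real n < t \<and> t < real (Suc n) \<and> g (Suc n) - g n = y * (M / (M\<^sup>2 + (t * y)\<^sup>2))" for n
  proof -
    have "\<exists>t. real n < t \<and> t < real (Suc n) \<and>
       arctan (real (Suc n) * y / M) - arctan (real n * y / M) = (real (Suc n) - real n) * (y * (M / (M\<^sup>2 + (t * y)\<^sup>2)))"
    proof (rule MVT2)
      fix t :: real
      have "M\<^sup>2 + (t * y)\<^sup>2 > 0" using M by (simp add: add_pos_nonneg)
      thus "((\<lambda>t. arctan (t * y / M)) has_real_derivative y * (M / (M\<^sup>2 + (t * y)\<^sup>2))) (at t)"
        using M by (auto intro!: derivative_eq_intros simp: field_simps power2_eq_square)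
    qed auto
    thus ?thesis by (simp add: g_def)
  qed
  have up: "y * f n \<le> g (Suc n) - g n" for n
  proof -
    obtain t where t: "real n < t" "t < real (Suc n)" "g (Suc n) - g n = y * (M / (M\<^sup>2 + (t * y)\<^sup>2))"
      using mvt by blast
    have "(t * y)\<^sup>2 \<le> (real (Suc n) * y)\<^sup>2" using t y by (intro power_mono mult_right_mono) auto
    hence "M / (M\<^sup>2 + (real (Suc n) * y)\<^sup>2) \<le> M / (M\<^sup>2 + (t * y)\<^sup>2)"
      using M by (intro divide_left_mono mult_pos_pos add_pos_nonneg) auto
    from mult_left_mono[OF this, of y] show ?thesis using y t by (simp add: f_def)
  qed
  have low: "y * f n \<ge> g (Suc (Suc n)) - g (Suc n)" for n
  proof -
    obtain t where t: "real (Suc n) < t" "t < real (Suc (Suc n))" "g (Suc (Suc n)) - g (Suc n) = y * (M / (M\<^sup>2 + (t * y)\<^sup>2))"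
      using mvt by blast
    have "(t * y)\<^sup>2 \<ge> (real (Suc n) * y)\<^sup>2" using t y by (intro power_mono mult_right_mono) auto
    hence "M / (M\<^sup>2 + (real (Suc n) * y)\<^sup>2) \<ge> M / (M\<^sup>2 + (t * y)\<^sup>2)"
      using M by (intro divide_left_mono mult_pos_pos add_pos_nonneg) auto
    from mult_left_mono[OF this, of y] show ?thesis using y t by (simp add: f_def)
  qed
  have glim: "g \<longlonglongrightarrow> pi / 2" unfolding g_def
  proof (rule filterlim_compose[OF tendsto_arctan_at_top])
    show "LIM n sequentially. real n * y / M :> at_top"
      using M y by real_asymp
  qed
  have s1: "(\<lambda>n. g (Suc n) - g n) sums (pi / 2)"
    using telescope_sums[OF glim] by (simp add: g_def)
  have s2: "(\<lambda>n. g (Suc (Suc n)) - g (Suc n)) sums (pi / 2 - arctan (y / M))"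
    using telescope_sums[OF LIMSEQ_Suc[OF glim]] by (simp add: g_def)
  have fpos: "y * f n \<ge> 0" for n using M y by (simp add: f_def)
  have "summable (\<lambda>n. y * f n)"
    by (rule summable_comparison_test[OF _ sums_summable[OF s1]]) (use up fpos in auto)
  hence sf: "summable f" using y by (simp add: summable_cmult_iff)
  thus "summable (\<lambda>n. M / (M\<^sup>2 + (real (Suc n) * y)\<^sup>2))" unfolding f_def .
  have sy: "(\<lambda>n. y * f n) sums (y * suminf f)" using sf by (intro sums_mult summable_sums)
  have "y * suminf f \<le> pi / 2" using sums_le[OF _ sy s1] up by blast
  thus "(\<Sum>n. M / (M\<^sup>2 + (real (Suc n) * y)\<^sup>2)) \<le> pi / (2 * y)"
    using y unfolding f_def[abs_def, symmetric] by (simp add: field_simps)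
  have "y * suminf f \<ge> pi / 2 - arctan (y / M)" using sums_le[OF _ s2 sy] low by blast
  thus "(\<Sum>n. M / (M\<^sup>2 + (real (Suc n) * y)\<^sup>2)) \<ge> pi / (2 * y) - arctan (y / M) / y"
    using y unfolding f_def[abs_def, symmetric] by (simp add: field_simps)
qed

section \<open>Eisenstein's double series summed in two orders\<close>

lemma inverse_squares_sums_real: "(\<lambda>n. 1 / (real n + 1)\<^sup>2) sums (pi\<^sup>2 / 6)"
  using inverse_squares_sums by (simp add: add.commute)

lemma summable_inverse_sinh_squared:
  fixes y :: real
  assumes y: "y > 0"
  shows "summable (\<lambda>n. 1 / sinh (pi * (real (Suc n) * y)) ^ 2)"
proof (rule summable_comparison_test)
  show "summable (\<lambda>n. 1 / (pi * y)\<^sup>2 * (1 / (real n + 1)\<^sup>2))"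
    by (intro summable_mult sums_summable[OF inverse_squares_sums_real])
  have "norm (1 / sinh (pi * (real (Suc n) * y)) ^ 2) \<le> 1 / (pi * y)\<^sup>2 * (1 / (real n + 1)\<^sup>2)" for n
  proof -
    define x where "x = pi * (real (Suc n) * y)"
    have x: "x > 0" using y by (simp add: x_def)
    have "sinh x - x \<ge> sinh 0 - 0"
    proof (rule DERIV_nonneg_imp_nondecreasing[where f = "\<lambda>x. sinh x - x"])
      fix t :: real
      show "\<exists>d. ((\<lambda>x. sinh x - x) has_real_derivative d) (at t) \<and> d \<ge> 0"
        by (rule exI[of _ "cosh t - 1"]) (auto intro!: derivative_eq_intros simp: cosh_real_ge_1)
    qed (use x in auto)
    hence "sinh x \<ge> x" by simp
    hence "sinh x ^ 2 \<ge> x ^ 2" using x by (intro power_mono) auto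
    hence "1 / sinh x ^ 2 \<le> 1 / x ^ 2" using x by (intro divide_left_mono mult_pos_pos) auto
    also have "1 / x ^ 2 = 1 / (pi * y)\<^sup>2 * (1 / (real n + 1)\<^sup>2)"
      by (simp add: x_def power_mult_distrib add.commute)
    finally show ?thesis by (simp add: x_def)
  qed
  thus "\<exists>N. \<forall>n\<ge>N. norm (1 / sinh (pi * (real (Suc n) * y)) ^ 2) \<le> 1 / (pi * y)\<^sup>2 * (1 / (real n + 1)\<^sup>2)"
    by blast
qed

text \<open>In classical notation \<open>1 - 6 * sinh_sum y\<close> is the Eisenstein series E_2 at
  \<open>\<i> y\<close>.\<close>

definition sinh_sum :: "real \<Rightarrow> real" where
  "sinh_sum y = (\<Sum>n. 1 / sinh (pi * (real (Suc n) * y)) ^ 2)"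

text \<open>Adds up the row sums of the double series, the first part through zeta(2). Used at y for
  the rows and at 1/y for the columns.\<close>

lemma sums_inverse_sinh_squared_diff:
  fixes y :: real
  assumes y: "y > 0"
  shows "(\<lambda>n. (1 / (real (Suc n) * y)\<^sup>2 - pi\<^sup>2 / sinh (pi * (real (Suc n) * y)) ^ 2) / 2) sums
           (pi\<^sup>2 / (12 * y\<^sup>2) - pi\<^sup>2 / 2 * sinh_sum y)"
proof -
  have "(\<lambda>n. 1 / (2 * y\<^sup>2) * (1 / (real n + 1)\<^sup>2) - pi\<^sup>2 / 2 * (1 / sinh (pi * (real (Suc n) * y)) ^ 2)) sums
          (1 / (2 * y\<^sup>2) * (pi\<^sup>2 / 6) - pi\<^sup>2 / 2 * sinh_sum y)"
    unfolding sinh_sum_def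
    by (intro sums_diff sums_mult inverse_squares_sums_real summable_sums summable_inverse_sinh_squared y)
  moreover have "1 / (2 * y\<^sup>2) * (1 / (real n + 1)\<^sup>2) - pi\<^sup>2 / 2 * (1 / sinh (pi * (real (Suc n) * y)) ^ 2)
     = (1 / (real (Suc n) * y)\<^sup>2 - pi\<^sup>2 / sinh (pi * (real (Suc n) * y)) ^ 2) / 2" for n
    by (simp add: diff_divide_distrib power_mult_distrib add.commute mult_ac)
  moreover have "1 / (2 * y\<^sup>2) * (pi\<^sup>2 / 6) = pi\<^sup>2 / (12 * y\<^sup>2)" by simp
  ultimately show ?thesis by (simp only:)
qed

text \<open>Fubini for series: domination by a product \<open>u n * u m\<close> makes the family
  absolutely summable over pairs, so each iterated sum equals the sum over all pairs.\<close>

lemma double_series_sums_swap: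
  fixes c :: "nat \<Rightarrow> nat \<Rightarrow> real"
  assumes bound: "\<And>n m. \<bar>c n m\<bar> \<le> K * (u n * u m)"
    and u: "summable u" "\<And>n. u n \<ge> 0"
    and rows: "\<And>n. c n sums r n" and cols: "\<And>m. (\<lambda>n. c n m) sums s m"
  obtains S where "r sums S" "s sums S"
proof -
  have uu: "u summable_on UNIV" using u by (simp add: summable_on_UNIV_nonneg_real_iff)
  have us: "(\<lambda>(n,m). K * (u n * u m)) summable_on UNIV \<times> UNIV"
  proof -
    have "(\<lambda>(n,m). u n * u m) summable_on UNIV \<times> UNIV"
    proof (rule summable_on_SigmaI)
      show "((\<lambda>y. case (x, y) of (n, m) \<Rightarrow> u n * u m) has_sum (u x * infsum u UNIV)) UNIV" for x
        using uu by (simp add: has_sum_cmult_right)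
      show "(\<lambda>x. u x * infsum u UNIV) summable_on UNIV"
        using uu by (rule summable_on_cmult_left)
    qed (use u in auto)
    from summable_on_cmult_right[OF this, of K] show ?thesis by (simp add: case_prod_unfold)
  qed
  have abs: "(\<lambda>x. norm (case x of (n, m) \<Rightarrow> c n m)) summable_on UNIV \<times> UNIV"
    by (rule Infinite_Sum.abs_summable_on_comparison_test'[OF us]) (use bound in auto)
  hence sm: "(\<lambda>(n, m). c n m) summable_on UNIV \<times> UNIV"
    by (rule abs_summable_summable)
  then obtain S where S: "((\<lambda>(n, m). c n m) has_sum S) (UNIV \<times> UNIV)"
    by (auto simp: summable_on_def)
  have ab: "summable (\<lambda>m. \<bar>c n m\<bar>)" "summable (\<lambda>m. \<bar>c m n\<bar>)" for n
  proof -
    have "summable (\<lambda>m. K * (u n * u m))" "summable (\<lambda>m. K * (u m * u n))"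
      using u by (auto intro!: summable_mult summable_mult2)
    thus "summable (\<lambda>m. \<bar>c n m\<bar>)" "summable (\<lambda>m. \<bar>c m n\<bar>)"
      by (auto intro!: summable_comparison_test[where f = "\<lambda>m. \<bar>_ m\<bar>"] bound exI[of _ 0] simp del: abs_mult)
  qed
  have "(r has_sum S) UNIV"
    by (rule has_sum_SigmaD[OF S]) (use norm_summable_imp_has_sum[OF _ rows] ab in simp)
  moreover have "(s has_sum S) UNIV"
    by (rule has_sum_SigmaD[OF S[THEN has_sum_swap[THEN iffD1]]])
       (use norm_summable_imp_has_sum[OF _ cols] ab in simp)
  ultimately show ?thesis using that has_sum_imp_sums by blast
qed

text \<open>Eisenstein's double series: the two orders of summation of the terms
  \<open>Re (1 / (M + \<i> N y)\<^sup>2)\<close> differ, and the difference is found by subtracting a telescoping double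
  series that turns it into an absolutely convergent one.\<close>

lemma sinh_sum_inversion:
  fixes y :: real
  assumes y: "y > 0"
  shows "pi\<^sup>2 / 12 * (1 + 1 / y\<^sup>2) - pi\<^sup>2 / 2 * (sinh_sum y + sinh_sum (1 / y) / y\<^sup>2) = pi / (2 * y)"
proof -
  define a where "a n m = (real (Suc m) ^ 2 - (real (Suc n) * y)\<^sup>2) / (real (Suc m) ^ 2 + (real (Suc n) * y)\<^sup>2)\<^sup>2" for n m
  \<comment> \<open>The real part of \<open>1 / (m + \<i> (n+1) y)\<close>. Its decrease from m to
    m+1 agrees with \<open>a n m\<close> up to a term of third order, which is absolutely summable
    over both indices.\<close>
  define g where "g n m = real m / ((real m)\<^sup>2 + (real (Suc n) * y)\<^sup>2)" for n m
  define h where "h m = (\<Sum>n. g n m)" for m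
  define A where "A n = (1 / (real (Suc n) * y)\<^sup>2 - pi\<^sup>2 / sinh (pi * (real (Suc n) * y)) ^ 2) / 2" for n
  define B where "B m = - (1 / y\<^sup>2) * ((1 / (real (Suc m) * (1 / y))\<^sup>2 - pi\<^sup>2 / sinh (pi * (real (Suc m) * (1 / y))) ^ 2) / 2)" for m
  have a_row: "a n sums A n" for n
    using sums_inverse_sinh_squared[of "real (Suc n) * y"] y by (simp add: a_def[abs_def] A_def)
  \<comment> \<open>Dividing M and N y by y exchanges the roles of the indices and flips the sign of
    the numerator, so a column for y is \<open>- 1 / y\<^sup>2\<close> times a row for 1/y.\<close>
  have a_col: "(\<lambda>n. a n m) sums B m" for m
  proof -
    have "a n m = - (1 / y\<^sup>2) * ((real (Suc n) ^ 2 - (real (Suc m) * (1 / y))\<^sup>2) / (real (Suc n) ^ 2 + (real (Suc m) * (1 / y))\<^sup>2)\<^sup>2)" for n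
    proof -
      define N where "N = real (Suc n)"
      define M where "M = real (Suc m)"
      have NM: "N > 0" "M > 0" by (simp_all add: N_def M_def)
      hence nz: "M\<^sup>2 + (N * y)\<^sup>2 \<noteq> 0" using y by (metis add_pos_pos less_irrefl mult_pos_pos zero_less_power)
      have "N\<^sup>2 + (M * (1 / y))\<^sup>2 = (M\<^sup>2 + (N * y)\<^sup>2) / y\<^sup>2" "N\<^sup>2 - (M * (1 / y))\<^sup>2 = - (M\<^sup>2 - (N * y)\<^sup>2) / y\<^sup>2"
        using y by (simp_all add: field_simps)
      hence "- (1 / y\<^sup>2) * ((N ^ 2 - (M * (1 / y))\<^sup>2) / (N ^ 2 + (M * (1 / y))\<^sup>2)\<^sup>2) =
             - (1 / y\<^sup>2) * ((- (M\<^sup>2 - (N * y)\<^sup>2) / y\<^sup>2) / ((M\<^sup>2 + (N * y)\<^sup>2) / y\<^sup>2)\<^sup>2)" by simp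
      also have "\<dots> = (M ^ 2 - (N * y)\<^sup>2) / (M ^ 2 + (N * y)\<^sup>2)\<^sup>2"
      proof -
        have "- (1 / q) * ((- p / q) / (w / q)\<^sup>2) = p / w\<^sup>2" if "q \<noteq> 0" "w \<noteq> 0" for p q w :: real
          using that by (simp add: field_simps power2_eq_square)
        from this[of "y\<^sup>2", OF _ nz] y show ?thesis by (metis zero_less_power less_irrefl)
      qed
      finally show ?thesis by (simp add: a_def N_def M_def)
    qed
    moreover have "(\<lambda>n. - (1 / y\<^sup>2) * ((real (Suc n) ^ 2 - (real (Suc m) * (1 / y))\<^sup>2) / (real (Suc n) ^ 2 + (real (Suc m) * (1 / y))\<^sup>2)\<^sup>2)) sums B m"
      unfolding B_def by (rule sums_mult, rule sums_inverse_sinh_squared) (use y in simp)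
    ultimately show ?thesis by simp
  qed
  \<comment> \<open>Along each row the differences telescope to \<open>g n 0 = 0\<close>. Summed
    over n first, they become differences of \<open>h\<close> and telescope to minus the limit of
    \<open>h\<close>; this discrepancy is the source of \<open>pi / (2 * y)\<close>.\<close>
  have b_row: "(\<lambda>m. g n m - g n (Suc m)) sums 0" for n
  proof -
    define q where "q = real (Suc n) * y"
    have "q > 0" using y by (simp add: q_def)
    hence "(\<lambda>m. real m / ((real m)\<^sup>2 + q\<^sup>2)) \<longlonglongrightarrow> 0" by real_asymp
    hence "g n \<longlonglongrightarrow> 0" by (simp add: g_def[abs_def] q_def)
    from telescope_sums'[OF this] show ?thesis by (simp add: g_def)
  qed
  have g_sums: "(\<lambda>n. g n m) sums h m" for m
  proof (cases "m = 0")
    case False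
    thus ?thesis using arctan_bounds_rational_series(1)[of "real m" y] y
      by (simp add: h_def g_def[abs_def] summable_sums)
  qed (simp add: h_def g_def)
  have h_lim: "h \<longlonglongrightarrow> pi / (2 * y)"
  proof (rule tendsto_sandwich)
    show "(\<lambda>m. pi / (2 * y) - arctan (y / real m) / y) \<longlonglongrightarrow> pi / (2 * y)"
    proof -
      have "(\<lambda>m. y / real m) \<longlonglongrightarrow> 0" by real_asymp
      hence "(\<lambda>m. pi / (2 * y) - arctan (y / real m) / y) \<longlonglongrightarrow> pi / (2 * y) - arctan 0 / y"
        using y by (intro tendsto_intros) auto
      thus ?thesis by simp
    qed
    show "\<forall>\<^sub>F m in sequentially. pi / (2 * y) - arctan (y / real m) / y \<le> h m"
      using eventually_gt_at_top[of 0]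
      by eventually_elim (use arctan_bounds_rational_series(3) y in \<open>auto simp: h_def g_def\<close>)
    show "\<forall>\<^sub>F m in sequentially. h m \<le> pi / (2 * y)"
      using eventually_gt_at_top[of 0]
      by eventually_elim (use arctan_bounds_rational_series(2) y in \<open>auto simp: h_def g_def\<close>)
  qed (rule tendsto_const)
  have bound: "\<bar>a n m - (g n m - g n (Suc m))\<bar> \<le> (1 / y powr (3/2)) * ((1 / real (Suc n) powr (3/2)) * (1 / real (Suc m) powr (3/2)))" for n m
  proof -
    define N where "N = real (Suc n) * y"
    define M where "M = real (Suc m)"
    define w where "w = Complex M N"
    have NM: "N > 0" "M > 0" using y by (simp_all add: N_def M_def)
    have nz: "w \<noteq> 0" "w - 1 \<noteq> 0" using NM by (auto simp: w_def complex_eq_iff)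
    have re_inv: "Re (1 / Complex p N) = p / (p\<^sup>2 + N\<^sup>2)" for p
      by (simp add: Re_divide)
    have re_sq: "Re (1 / (Complex p N)\<^sup>2) = (p\<^sup>2 - N\<^sup>2) / (p\<^sup>2 + N\<^sup>2)\<^sup>2" for p
    proof -
      define u where "u = 1 / Complex p N"
      have "1 / (Complex p N)\<^sup>2 = u * u" by (simp add: u_def power2_eq_square)
      also have "Re (u * u) = (Re u)\<^sup>2 - (Im u)\<^sup>2" by (simp add: power2_eq_square)
      also have "\<dots> = (p / (p\<^sup>2 + N\<^sup>2))\<^sup>2 - (N / (p\<^sup>2 + N\<^sup>2))\<^sup>2"
        by (simp add: u_def Re_divide Im_divide)
      finally show ?thesis by (simp add: power_divide diff_divide_distrib)
    qed
    have "a n m - (g n m - g n (Suc m)) = Re (1 / w\<^sup>2) - (Re (1 / (w - 1)) - Re (1 / w))"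
    proof -
      have "w - 1 = Complex (real m) N" by (simp add: w_def complex_eq_iff M_def)
      hence "Re (1 / w\<^sup>2) - (Re (1 / (w - 1)) - Re (1 / w)) =
               (M\<^sup>2 - N\<^sup>2) / (M\<^sup>2 + N\<^sup>2)\<^sup>2 - (real m / ((real m)\<^sup>2 + N\<^sup>2) - M / (M\<^sup>2 + N\<^sup>2))"
        by (simp only: re_inv re_sq) (simp only: re_inv re_sq w_def)
      thus ?thesis by (simp only: a_def g_def N_def M_def)
    qed
    also have "\<dots> = Re (1 / w\<^sup>2 - (1 / (w - 1) - 1 / w))" by simp
    also have "1 / w\<^sup>2 - (1 / (w - 1) - 1 / w) = - 1 / (w\<^sup>2 * (w - 1))"
      using nz by (simp add: field_simps power2_eq_square)
    finally have "\<bar>a n m - (g n m - g n (Suc m))\<bar> \<le> norm (- 1 / (w\<^sup>2 * (w - 1)))"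
      using abs_Re_le_cmod by simp
    also have "\<dots> = 1 / (norm w ^ 2 * norm (w - 1))" by (simp add: norm_divide norm_mult norm_power)
    \<comment> \<open>The real part of \<open>w - 1\<close> vanishes for m = 0, so only its
      imaginary part N is a safe lower bound. Splitting \<open>norm w ^ 2\<close> into the powers
      3/2 and 1/2 then leaves exponent 3/2 on both indices, enough for a product of summable
      sequences.\<close>
    also have "\<dots> \<le> 1 / ((M powr (3/2) * N powr (1/2)) * N)"
    proof (intro divide_left_mono mult_mono)
      show "N \<le> norm (w - 1)" using abs_Im_le_cmod[of "w - 1"] by (simp add: w_def)
      have "norm w \<ge> M" "norm w \<ge> N" using abs_Im_le_cmod[of w] abs_Re_le_cmod[of w] by (simp_all add: w_def)
      hence "M powr (3/2) * N powr (1/2) \<le> norm w powr (3/2) * norm w powr (1/2)"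
        using NM by (intro mult_mono powr_mono2) auto
      also have "\<dots> = norm w ^ 2" using nz by (simp flip: powr_add)
      finally show "M powr (3/2) * N powr (1/2) \<le> norm w ^ 2" .
    qed (use NM nz in auto)
    also have "(M powr (3/2) * N powr (1/2)) * N = y powr (3/2) * (real (Suc n) powr (3/2) * real (Suc m) powr (3/2))"
    proof -
      have "N powr (1/2) * N = N powr (1/2) * N powr 1" using NM by simp
      also have "\<dots> = N powr (1/2 + 1)" by (rule powr_add[symmetric])
      also have "\<dots> = N powr (3/2)" by simp
      also have "\<dots> = real (Suc n) powr (3/2) * y powr (3/2)" unfolding N_def using y by (intro powr_mult)
      finally have e: "N powr (1/2) * N = real (Suc n) powr (3/2) * y powr (3/2)" .
      have "(M powr (3/2) * N powr (1/2)) * N = M powr (3/2) * (N powr (1/2) * N)" by simp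
      thus ?thesis unfolding e M_def by (simp only: mult_ac)
    qed
    finally show ?thesis by simp
  qed
  have us: "summable (\<lambda>n. 1 / real (Suc n) powr (3/2))"
  proof -
    have "summable (\<lambda>n. real n powr (-(3/2)))" by (subst summable_real_powr_iff) auto
    hence "summable (\<lambda>n. real (Suc n) powr (-(3/2)))" by (subst summable_Suc_iff)
    thus ?thesis by (simp only: powr_minus_divide)
  qed
  obtain S where S1: "(\<lambda>n. A n - 0) sums S" and S2: "(\<lambda>m. B m - (h m - h (Suc m))) sums S"
    by (rule double_series_sums_swap[OF bound us])
       (auto intro: sums_diff[OF a_row b_row] sums_diff[OF a_col] sums_diff[OF g_sums g_sums])
  have "h 0 = 0" by (simp add: h_def g_def)
  hence "(\<lambda>m. h m - h (Suc m)) sums (- (pi / (2 * y)))"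
    using telescope_sums'[OF h_lim] by simp
  from sums_add[OF S2 this] have SB: "B sums (S - pi / (2 * y))" by simp
  have "A sums (pi\<^sup>2 / (12 * y\<^sup>2) - pi\<^sup>2 / 2 * sinh_sum y)"
    unfolding A_def[abs_def] by (rule sums_inverse_sinh_squared_diff) fact
  hence SA: "S = pi\<^sup>2 / (12 * y\<^sup>2) - pi\<^sup>2 / 2 * sinh_sum y" using S1 by (simp add: sums_iff)
  have "B sums (- (1 / y\<^sup>2) * (pi\<^sup>2 / (12 * (1/y)\<^sup>2) - pi\<^sup>2 / 2 * sinh_sum (1/y)))"
    unfolding B_def[abs_def] by (rule sums_mult, rule sums_inverse_sinh_squared_diff) (use y in simp)
  with SB have "S - pi / (2 * y) = - (1 / y\<^sup>2) * (pi\<^sup>2 / (12 * (1/y)\<^sup>2) - pi\<^sup>2 / 2 * sinh_sum (1/y))"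
    using sums_unique2 by blast
  also have "\<dots> = - (pi\<^sup>2 / 12) + pi\<^sup>2 / 2 * (sinh_sum (1/y) / y\<^sup>2)"
    using y by (simp add: field_simps)
  finally have "S - pi / (2 * y) = - (pi\<^sup>2 / 12) + pi\<^sup>2 / 2 * (sinh_sum (1/y) / y\<^sup>2)" .
  moreover have "pi\<^sup>2 / 12 * (1 + 1 / y\<^sup>2) = pi\<^sup>2 / 12 + pi\<^sup>2 / (12 * y\<^sup>2)"
    using y by (simp add: field_simps)
  ultimately show ?thesis using SA unfolding distrib_left[of "pi\<^sup>2 / 2"] by linarith
qed

text \<open>With \<open>z = exp (- 2 * t)\<close>, \<open>1 / (4 * sinh t ^ 2)\<close> is the sum of
  \<open>k * z ^ k\<close> over positive k. Inserting this gives a nonnegative double series, and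
  summing the geometric series over n first produces the Lambert series.\<close>

lemma sinh_sum_eq_Lambert:
  fixes y :: real
  assumes y: "y > 0"
  shows "(\<lambda>n. real (Suc n) / (exp (2 * pi * real (Suc n) * y) - 1)) sums (sinh_sum y / 4)"
proof -
  define F where "F n k = real (Suc k) * exp (- 2 * pi * y * real (Suc n) * real (Suc k))" for n k
  have row: "F n sums (1 / 4 * (1 / sinh (pi * (real (Suc n) * y)) ^ 2))" for n
  proof -
    define t where "t = pi * (real (Suc n) * y)"
    have t: "t > 0" using y by (simp add: t_def)
    define z where "z = exp (- 2 * t)"
    have z: "z > 0" "z < 1" using t by (auto simp: z_def)
    have "(\<lambda>k. z * (real (Suc k) * z ^ k)) sums (z * (1 / (1 - z)\<^sup>2))"
      using z by (intro sums_mult geometric_deriv_sums) auto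
    moreover have "z * (real (Suc k) * z ^ k) = F n k" for k
    proof -
      have "z * (real (Suc k) * z ^ k) = real (Suc k) * z ^ Suc k" by simp
      also have "z ^ Suc k = exp (real (Suc k) * (- 2 * t))" unfolding z_def by (rule exp_of_nat_mult[symmetric])
      finally show ?thesis by (simp add: F_def t_def algebra_simps)
    qed
    moreover have "z * (1 / (1 - z)\<^sup>2) = 1 / 4 * (1 / sinh t ^ 2)"
    proof -
      have "sinh t = exp t * (1 - z) / 2"
        by (simp add: sinh_field_def z_def algebra_simps flip: exp_add)
      hence "sinh t ^ 2 = (exp t) ^ 2 * (1 - z) ^ 2 / 4" by (simp only: power_mult_distrib power_divide) simp
      moreover have "(exp t) ^ 2 * z = 1" by (simp add: z_def power2_eq_square flip: exp_add)
      hence "(exp t) ^ 2 = 1 / z" using z by (simp add: field_simps)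
      moreover have "sinh t \<noteq> 0" using t by simp
      ultimately show ?thesis using z by (simp add: field_simps)
    qed
    ultimately show ?thesis by (simp add: t_def)
  qed
  have col: "(\<lambda>n. F n k) sums (real (Suc k) / (exp (2 * pi * real (Suc k) * y) - 1))" for k
  proof -
    define z where "z = exp (- (2 * pi * real (Suc k) * y))"
    have z: "z > 0" "z < 1" using y by (auto simp: z_def)
    have "(\<lambda>n. real (Suc k) * z * z ^ n) sums (real (Suc k) * z * (1 / (1 - z)))"
      using z by (intro sums_mult geometric_sums) auto
    moreover have "real (Suc k) * z * z ^ n = F n k" for n
    proof -
      have "real (Suc k) * z * z ^ n = real (Suc k) * z ^ Suc n" by simp
      also have "z ^ Suc n = exp (real (Suc n) * (- (2 * pi * real (Suc k) * y)))" unfolding z_def by (rule exp_of_nat_mult[symmetric])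
      finally show ?thesis by (simp add: F_def algebra_simps)
    qed
    moreover have "real (Suc k) * z * (1 / (1 - z)) = real (Suc k) / (exp (2 * pi * real (Suc k) * y) - 1)"
    proof -
      have "exp (2 * pi * real (Suc k) * y) = 1 / z"
        unfolding z_def exp_minus divide_inverse by simp
      thus ?thesis unfolding \<open>exp (2 * pi * real (Suc k) * y) = 1 / z\<close>
        using z by (simp add: field_simps)
    qed
    ultimately show ?thesis by simp
  qed
  have nonneg: "F n k \<ge> 0" for n k by (simp add: F_def)
  have hs: "(f has_sum s) UNIV" if "f sums s" "\<And>n. f n \<ge> 0" for f :: "nat \<Rightarrow> real" and s
    using that by (intro norm_summable_imp_has_sum) (auto simp: sums_iff)
  have tot: "(\<lambda>n. 1 / 4 * (1 / sinh (pi * (real (Suc n) * y)) ^ 2)) sums (sinh_sum y / 4)"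
    using sums_mult[OF summable_sums[OF summable_inverse_sinh_squared[OF y]], of "1/4"]
    by (simp add: sinh_sum_def)
  have "((\<lambda>(n,k). F n k) has_sum (sinh_sum y / 4)) (UNIV \<times> UNIV)"
  proof (rule has_sum_SigmaI)
    show "((\<lambda>k. case (n, k) of (n, k) \<Rightarrow> F n k) has_sum (1 / 4 * (1 / sinh (pi * (real (Suc n) * y)) ^ 2))) UNIV" for n
      using hs[OF row nonneg] by simp
    show "((\<lambda>n. 1 / 4 * (1 / sinh (pi * (real (Suc n) * y)) ^ 2)) has_sum (sinh_sum y / 4)) UNIV"
      by (rule hs[OF tot]) simp
    show "(\<lambda>(n, k). F n k) summable_on UNIV \<times> UNIV"
    proof (rule summable_on_SigmaI)
      show "((\<lambda>k. case (n, k) of (n, k) \<Rightarrow> F n k) has_sum (1 / 4 * (1 / sinh (pi * (real (Suc n) * y)) ^ 2))) UNIV" for n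
        using hs[OF row nonneg] by simp
      show "(\<lambda>n. 1 / 4 * (1 / sinh (pi * (real (Suc n) * y)) ^ 2)) summable_on UNIV"
        using hs[OF tot] by (auto simp: summable_on_def)
    qed (use nonneg in auto)
  qed
  hence "((\<lambda>(k,n). F n k) has_sum (sinh_sum y / 4)) (UNIV \<times> UNIV)"
    by (subst (asm) has_sum_swap) (simp add: case_prod_unfold)
  hence "((\<lambda>k. real (Suc k) / (exp (2 * pi * real (Suc k) * y) - 1)) has_sum (sinh_sum y / 4)) UNIV"
    by (rule has_sum_SigmaD) (use hs[OF col nonneg] in simp)
  thus ?thesis by (rule has_sum_imp_sums)
qed

section \<open>The modular relation\<close>

text \<open>The logarithm of the product for \<open>L (\<i> y)\<close>; it is real for positive y
  because there every factor lies between 0 and 1.\<close>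

definition log_Delta :: "real \<Rightarrow> real" where
  "log_Delta y = - 2 * pi * y + 24 * (\<Sum>n. ln (1 - exp (- 2 * pi * real (Suc n) * y)))"

text \<open>Termwise differentiation turns the logarithms into a Lambert series, so the derivative
  is -2 pi times E_2 at \<open>\<i> y\<close>. Uniform convergence is local: it is established on
  \<open>{y/2<..}\<close>.\<close>

lemma
  fixes y :: real
  assumes y: "y > 0"
  shows summable_ln_euler: "summable (\<lambda>n. ln (1 - exp (- 2 * pi * real (Suc n) * y)))" (is ?th1)
    and has_field_derivative_log_Delta: "(log_Delta has_real_derivative (- 2 * pi + 12 * pi * sinh_sum y)) (at y)" (is ?th2)
proof -
  \<comment> \<open>The value of \<open>exp (- 2 * pi * t)\<close> at the left end t = y/2, hence a
    geometric majorant on the whole of \<open>{y/2<..}\<close>.\<close>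
  define r where "r = exp (- pi * y)"
  have r: "0 < r" "r < 1" using y by (auto simp: r_def)
  define f' where "f' n t = 2 * pi * real (Suc n) / (exp (2 * pi * real (Suc n) * t) - 1)" for n t
  have e1: "exp (2 * pi * real (Suc n) * t) > 1" if "t > 0" for n t
    using that by simp
  have der: "((\<lambda>t. ln (1 - exp (- 2 * pi * real (Suc n) * t))) has_real_derivative f' n t) (at t within S)"
    if "t > 0" for n t S
  proof -
    define c where "c = 2 * pi * real (Suc n)"
    have c: "c > 0" by (simp add: c_def)
    have "exp (c * t) > 1" using c that by simp
    hence "((\<lambda>t. ln (1 - exp (- c * t))) has_real_derivative c / (exp (c * t) - 1)) (at t within S)"
      using c that by (auto intro!: derivative_eq_intros simp: exp_minus field_simps)
    thus ?thesis by (simp add: c_def f'_def)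
  qed
  have bound: "\<bar>f' n t\<bar> \<le> 2 * pi * r / (1 - r) * (real (Suc n) * r ^ n)" if t: "t \<in> {y/2<..}" for n t
  proof -
    have t0: "t > 0" using t y by auto
    define E where "E = exp (2 * pi * real (Suc n) * t)"
    have "r ^ Suc n = exp (real (Suc n) * (- pi * y))" unfolding r_def by (rule exp_of_nat_mult[symmetric])
    hence "inverse (r ^ Suc n) = exp (2 * pi * real (Suc n) * (y / 2))"
      by (simp add: exp_minus[symmetric] mult_ac)
    also have "\<dots> \<le> E" unfolding E_def using t by (intro exp_mono mult_left_mono) auto
    finally have E: "1 / r ^ Suc n \<le> E" by (simp add: inverse_eq_divide)
    have "r ^ Suc n \<le> r" using r power_decreasing[of 1 "Suc n" r] by simp
    hence "(1 - r) / r ^ Suc n \<le> (1 - r ^ Suc n) / r ^ Suc n" using r by (intro divide_right_mono) auto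
    also have "\<dots> = 1 / r ^ Suc n - 1" using r by (simp add: diff_divide_distrib)
    also have "\<dots> \<le> E - 1" using E by simp
    finally have "2 * pi * real (Suc n) / (E - 1) \<le> 2 * pi * real (Suc n) / ((1 - r) / r ^ Suc n)"
      using r e1[OF t0, of n] by (intro divide_left_mono mult_pos_pos) (auto simp: E_def)
    also have "\<dots> = 2 * pi * r / (1 - r) * (real (Suc n) * r ^ n)" by simp
    finally have "f' n t \<le> 2 * pi * r / (1 - r) * (real (Suc n) * r ^ n)" by (simp add: f'_def E_def)
    moreover have "f' n t \<ge> 0" unfolding f'_def using e1[OF t0, of n] by (intro divide_nonneg_nonneg) auto
    ultimately show ?thesis by simp
  qed
  have uc: "uniformly_convergent_on {y/2<..} (\<lambda>n t. \<Sum>i<n. f' i t)"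
  proof (rule Weierstrass_m_test')
    show "summable (\<lambda>n. 2 * pi * r / (1 - r) * (real (Suc n) * r ^ n))"
      using r geometric_deriv_sums[of r] by (intro summable_mult) (auto simp: sums_iff)
  qed (use bound in auto)
  have sm: "summable (\<lambda>n. ln (1 - exp (- 2 * pi * real (Suc n) * y)))"
  proof (rule summable_comparison_test[OF exI[of _ 0]], safe)
    show "summable (\<lambda>n. 1 / (2 * pi) * (2 * pi * r / (1 - r) * (real (Suc n) * r ^ n)))"
      using r geometric_deriv_sums[of r] by (intro summable_mult) (auto simp: sums_iff)
    fix n
    define E where "E = exp (2 * pi * real (Suc n) * y)"
    have E: "E > 1" unfolding E_def by (rule e1[OF y])
    have i: "exp (- 2 * pi * real (Suc n) * y) = 1 / E" by (simp add: E_def exp_minus inverse_eq_divide)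
    have pos: "1 - 1 / E > 0" using E by simp
    \<comment> \<open>From \<open>ln u \<le> u - 1\<close> at \<open>u = 1 / (1 - 1 / E)\<close> the
      logarithm is at most \<open>1 / (E - 1)\<close> in absolute value, hence at most the
      derivative term divided by 2 pi. The majorant of the derivatives thus serves here too.\<close>
    have "- ln (1 - 1 / E) = ln (inverse (1 - 1 / E))" using pos by (simp add: ln_inverse)
    also have "\<dots> \<le> inverse (1 - 1 / E) - 1" using pos by (intro ln_le_minus_one) simp
    also have "\<dots> = 1 / (E - 1)" using E by (simp add: field_simps)
    also have "\<dots> \<le> 1 / (2 * pi) * f' n y"
    proof -
      have "1 / (E - 1) \<le> real (Suc n) / (E - 1)" using E by (intro divide_right_mono) auto
      thus ?thesis by (simp add: f'_def E_def)
    qed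
    finally have "norm (ln (1 - 1 / E)) \<le> 1 / (2 * pi) * f' n y" using E by simp
    also have "\<dots> \<le> 1 / (2 * pi) * (2 * pi * r / (1 - r) * (real (Suc n) * r ^ n))"
      using bound[of y n] y by (intro mult_left_mono) auto
    finally show "norm (ln (1 - exp (- 2 * pi * real (Suc n) * y))) \<le>
        1 / (2 * pi) * (2 * pi * r / (1 - r) * (real (Suc n) * r ^ n))" unfolding i .
  qed
  thus ?th1 .
  have "((\<lambda>t. \<Sum>n. ln (1 - exp (- 2 * pi * real (Suc n) * t))) has_real_derivative (\<Sum>n. f' n y)) (at y)"
  proof (rule has_field_derivative_series'(2)[where S = "{y/2<..}" and x0 = y])
    show "y \<in> interior {y/2<..}" using y by (simp add: interior_open)
  qed (use y der uc sm in \<open>auto simp del: of_nat_Suc\<close>)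
  also have "(\<Sum>n. f' n y) = pi / 2 * sinh_sum y"
    using sums_mult[OF sinh_sum_eq_Lambert[OF y], of "2 * pi"]
    by (intro sums_unique[symmetric]) (simp add: f'_def[abs_def])
  finally show ?th2 unfolding log_Delta_def[abs_def]
    by (auto intro!: derivative_eq_intros)
qed

text \<open>The difference \<open>D\<close> of the two sides has derivative zero: up to the factor
  24/pi this is exactly \<open>sinh_sum_inversion\<close>. Its constant value is
  \<open>D 1 = 0\<close>, since 1 is fixed by inversion.\<close>

lemma log_Delta_inversion:
  fixes y :: real
  assumes y: "y > 0"
  shows "log_Delta (1 / y) = log_Delta y + 12 * ln y"
proof -
  define D where "D t = log_Delta (1 / t) - log_Delta t - 12 * ln t" for t
  have "\<exists>c. \<forall>t\<in>{0<..}. D t = c"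
  proof (rule has_field_derivative_zero_constant)
    fix t :: real assume "t \<in> {0<..}"
    hence t: "t > 0" by simp
    have "(D has_real_derivative ((- 2 * pi + 12 * pi * sinh_sum (1 / t)) * (- (1 / t\<^sup>2)) - (- 2 * pi + 12 * pi * sinh_sum t) - 12 * (1 / t))) (at t)"
      unfolding D_def[abs_def] using t
      by (auto intro!: derivative_eq_intros DERIV_chain2[OF has_field_derivative_log_Delta] has_field_derivative_log_Delta
               simp: power2_eq_square)
    moreover have "(- 2 * pi + 12 * pi * sinh_sum (1 / t)) * (- (1 / t\<^sup>2)) - (- 2 * pi + 12 * pi * sinh_sum t) - 12 * (1 / t)
       = 24 / pi * (pi\<^sup>2 / 12 * (1 + 1 / t\<^sup>2) - pi\<^sup>2 / 2 * (sinh_sum t + sinh_sum (1 / t) / t\<^sup>2)) - 12 / t"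
      using t by (simp add: field_simps power2_eq_square)
    ultimately have "(D has_real_derivative 0) (at t)"
      unfolding sinh_sum_inversion[OF t] using t by simp
    thus "(D has_real_derivative 0) (at t within {0<..})" by (rule has_field_derivative_at_within)
  qed auto
  then obtain c where "\<And>t. t > 0 \<Longrightarrow> D t = c" by auto
  from this[of y] this[of 1] y show ?thesis by (simp add: D_def)
qed

text \<open>Exponentiating the convergent series of logarithms recovers the infinite product, which
  ties the real-variable identity to \<open>L\<close>.\<close>

lemma L_imaginary_axis:
  fixes y :: real
  assumes y: "y > 0"
  shows "L (\<i> * of_real y) = of_real (exp (log_Delta y))"
proof -
  define q where "q = exp (- 2 * pi * y)"
  define f where "f n = ln (1 - exp (- 2 * pi * real (Suc n) * y))" for n
  have sf: "summable f" unfolding f_def by (rule summable_ln_euler[OF y])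
  have qn: "exp (24 * f n) = (1 - q ^ Suc n) ^ 24" for n
  proof -
    have "q ^ Suc n = exp (real (Suc n) * (- 2 * pi * y))" unfolding q_def by (rule exp_of_nat_mult[symmetric])
    hence qq: "q ^ Suc n = exp (- 2 * pi * real (Suc n) * y)" by (simp add: mult_ac)
    moreover have "q ^ Suc n < 1" unfolding qq using y by simp
    ultimately have "exp (f n) = 1 - q ^ Suc n" by (simp add: f_def)
    thus ?thesis using exp_of_nat_mult[of 24 "f n"] by simp
  qed
  have "exp (2 * of_real pi * \<i> * (\<i> * of_real y)) = (of_real q :: complex)"
    unfolding q_def exp_of_real[symmetric] by (simp add: algebra_simps)
  hence "L (\<i> * of_real y) = of_real q * (\<Prod>n. (1 - of_real q ^ Suc n) ^ 24)"
    by (simp add: L_def Delta_q_def)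
  also have "(\<lambda>n. (1 - complex_of_real q ^ Suc n) ^ 24) = (\<lambda>n. exp (of_real (24 * f n)))"
    unfolding exp_of_real qn by simp
  also have "(\<Prod>n. exp (complex_of_real (24 * f n))) = exp (\<Sum>n. of_real (24 * f n))"
    using sf by (intro prodinf_exp) (simp add: summable_mult del: of_real_mult)
  also have "(\<Sum>n. complex_of_real (24 * f n)) = of_real (24 * suminf f)"
    using sf by (intro sums_unique[symmetric] sums_of_real sums_mult summable_sums)
  also have "of_real q * exp (of_real (24 * suminf f)) = complex_of_real (q * exp (24 * suminf f))"
    unfolding exp_of_real by (rule of_real_mult[symmetric])
  also have "q * exp (24 * suminf f) = exp (log_Delta y)"
    by (simp add: q_def log_Delta_def f_def[abs_def] flip: exp_add)
  finally show ?thesis .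
qed

lemma L_inversion_imaginary_axis:
  fixes y :: real
  assumes y: "y > 0"
  shows "L (\<i> * of_real (1 / y)) = of_real (y ^ 12) * L (\<i> * of_real y)"
proof -
  have "exp (log_Delta (1 / y)) = exp (log_Delta y) * exp (12 * ln y)"
    unfolding log_Delta_inversion[OF y] by (rule exp_add)
  also have "exp (12 * ln y) = y ^ 12" using y exp_of_nat_mult[of 12 "ln y"] by simp
  finally show ?thesis using y L_imaginary_axis[of "1 / y"] L_imaginary_axis[of y] by simp
qed

section \<open>The modular relation on the whole upper half-plane\<close>

lemma L_holomorphic: "L holomorphic_on {z. Im z > 0}"
proof -
  have "(Delta_q \<circ> (\<lambda>z. exp (2 * of_real pi * \<i> * z))) holomorphic_on {z. Im z > 0}"
    by (rule holomorphic_on_compose_gen[OF _ Delta_q_holomorphic]) (auto intro!: holomorphic_intros)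
  thus ?thesis by (simp add: L_def[abs_def] o_def)
qed

text \<open>Identity theorem: both sides are holomorphic on the connected upper half-plane and agree
  on the imaginary axis, where \<open>(\<i> y)^12 = y^12\<close>.\<close>

lemma L_inversion:
  assumes z: "Im z > 0"
  shows "L (- 1 / z) = z ^ 12 * L z"
proof -
  define H where "H = {z. Im z > 0}"
  define f where "f z = L (- 1 / z) - z ^ 12 * L z" for z
  have inv: "Im (- 1 / w) > 0" if "Im w > 0" for w
    using that by (auto simp: Im_divide intro!: divide_pos_pos add_nonneg_pos)
  have nz: "w \<noteq> 0" if "Im w > 0" for w using that by auto
  have Hopen: "open H" "connected H" unfolding H_def
    by (auto intro: open_halfspace_Im_gt convex_connected convex_halfspace_Im_gt)
  have "(L \<circ> (\<lambda>z. - 1 / z)) holomorphic_on H" unfolding H_def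
    by (rule holomorphic_on_compose_gen[OF _ L_holomorphic]) (use inv nz in \<open>auto intro!: holomorphic_intros\<close>)
  hence hol: "f holomorphic_on H" unfolding f_def[abs_def] using L_holomorphic
    by (auto intro!: holomorphic_intros simp: o_def H_def)
  have "f z = 0"
  proof (rule analytic_continuation[OF hol Hopen(1) Hopen(2)])
    show "(\<lambda>y. \<i> * of_real y) ` {0<..} \<subseteq> H" by (auto simp: H_def)
    show "\<i> \<in> H" "z \<in> H" using z by (auto simp: H_def)
    show "\<i> islimpt (\<lambda>y. \<i> * of_real y) ` {0<..}"
      unfolding islimpt_sequential
    proof (intro exI conjI allI)
      show "\<i> * of_real (1 + 1 / real (Suc n)) \<in> (\<lambda>y. \<i> * of_real y) ` {0<..} - {\<i>}" for n
        by (auto simp: complex_eq_iff intro!: imageI add_pos_pos)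
      have "(\<lambda>n. 1 / real (Suc n)) \<longlonglongrightarrow> 0" by real_asymp
      hence "(\<lambda>n. \<i> * complex_of_real (1 + 1 / real (Suc n))) \<longlonglongrightarrow> \<i> * of_real (1 + 0)"
        by (intro tendsto_intros)
      thus "(\<lambda>n. \<i> * complex_of_real (1 + 1 / real (Suc n))) \<longlonglongrightarrow> \<i>" by simp
    qed
    fix w assume "w \<in> (\<lambda>y. \<i> * of_real y) ` {0<..}"
    then obtain y where y: "y > 0" "w = \<i> * of_real y" by auto
    have "- 1 / w = \<i> * of_real (1 / y)" using y by (simp add: field_simps)
    moreover have "w ^ 12 = of_real (y ^ 12)" using y by (simp add: power_mult_distrib)
    ultimately show "f w = 0" using L_inversion_imaginary_axis[OF y(1)] y by (simp add: f_def)
  qed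
  thus ?thesis by (simp add: f_def)
qed

section \<open>Hecke's bound and the Dirichlet series\<close>

lemma norm_ramanujan_tau_summable:
  assumes "0 \<le> r" "r < 1"
  shows "summable (\<lambda>m. norm (ramanujan_tau m) * r ^ m)"
proof -
  define s where "s = (1 + r) / 2"
  have s: "0 < s" "s < 1" "r < s" using assms by (auto simp: s_def)
  \<comment> \<open>The point of the imaginary axis with nome s. Convergence of the power series at
    the larger radius s gives absolute convergence at r.\<close>
  define x where "x = \<i> * of_real (- ln s / (2 * pi))"
  have "Im x > 0" using s by (simp add: x_def divide_neg_pos)
  from ramanujan_tau_sums[OF this]
  have "summable (\<lambda>m. ramanujan_tau m * exp (2 * of_real pi * \<i> * x) ^ m)" by (simp add: sums_iff)
  moreover have "exp (2 * of_real pi * \<i> * x) = of_real s"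
  proof -
    have "2 * of_real pi * \<i> * x = of_real (ln s)" by (simp add: x_def)
    thus ?thesis using s by (simp only: exp_of_real exp_ln)
  qed
  ultimately have "summable (\<lambda>m. ramanujan_tau m * of_real s ^ m)" by simp
  from powser_insidea[OF this, of "of_real r"] show ?thesis
    using s assms by (simp add: norm_mult norm_power)
qed

lemma norm_nome: "norm (exp (2 * of_real pi * \<i> * z)) = exp (- 2 * pi * Im z)"
  by simp

lemma L_periodic: "L (z + of_int n) = L z"
proof -
  have "2 * of_real pi * \<i> * (z + of_int n) = 2 * of_real pi * \<i> * z + (of_int (2 * n) * pi) * \<i>"
    by (simp add: algebra_simps)
  hence "exp (2 * of_real pi * \<i> * (z + of_int n)) = exp (2 * of_real pi * \<i> * z)"
    unfolding exp_eq by blast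
  thus ?thesis by (simp only: L_def)
qed

text \<open>Because \<open>ramanujan_tau 0 = 0\<close>, one factor
  \<open>norm q = exp (- 2 * pi * Im z)\<close> splits off the q-series; what remains is bounded
  uniformly for \<open>norm q \<le> exp (- pi)\<close>.\<close>

lemma L_exponential_decay:
  obtains K where "K > 0" "\<And>z. Im z \<ge> 1 / 2 \<Longrightarrow> norm (L z) \<le> K * exp (- 2 * pi * Im z)"
proof -
  define r where "r = exp (- pi)"
  have r: "0 < r" "r < 1" by (auto simp: r_def)
  have sr: "summable (\<lambda>m. norm (ramanujan_tau m) * r ^ m)" using r by (intro norm_ramanujan_tau_summable) auto
  define K where "K = (\<Sum>m. norm (ramanujan_tau m) * r ^ m) / r"
  have "norm (L z) \<le> K * exp (- 2 * pi * Im z)" if z: "Im z \<ge> 1 / 2" for z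
  proof -
    define q where "q = exp (2 * of_real pi * \<i> * z)"
    define p where "p = norm q"
    have p: "p = exp (- 2 * pi * Im z)" unfolding p_def q_def by (rule norm_nome)
    have pr: "p > 0" "p \<le> r" using z by (auto simp: p r_def)
    have le: "norm (ramanujan_tau m * q ^ m) \<le> p / r * (norm (ramanujan_tau m) * r ^ m)" for m
    proof (cases m)
      case (Suc k)
      have "p ^ m \<le> p / r * r ^ m" using pr r by (simp add: Suc power_mono)
      hence "norm (ramanujan_tau m) * p ^ m \<le> norm (ramanujan_tau m) * (p / r * r ^ m)"
        by (intro mult_left_mono) auto
      thus ?thesis by (simp add: norm_mult norm_power p_def mult_ac)
    qed (simp add: ramanujan_tau_0)
    have "norm (L z) \<le> (\<Sum>m. p / r * (norm (ramanujan_tau m) * r ^ m))"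
    proof -
      have sm: "summable (\<lambda>m. p / r * (norm (ramanujan_tau m) * r ^ m))" by (intro summable_mult sr)
      have "(\<lambda>m. ramanujan_tau m * q ^ m) sums L z"
        using ramanujan_tau_sums[of z] z by (simp add: q_def)
      hence "L z = (\<Sum>m. ramanujan_tau m * q ^ m)" by (simp add: sums_iff)
      also have "norm \<dots> \<le> (\<Sum>m. p / r * (norm (ramanujan_tau m) * r ^ m))"
        by (rule norm_suminf_le[OF le sm])
      finally show ?thesis .
    qed
    also have "\<dots> = K * p" using sr by (subst suminf_mult) (auto simp: K_def)
    finally show ?thesis unfolding p .
  qed
  moreover have "K * exp t \<le> (\<bar>K\<bar> + 1) * exp t" for t :: real
    by (intro mult_right_mono) auto
  ultimately have "norm (L z) \<le> (\<bar>K\<bar> + 1) * exp (- 2 * pi * Im z)" if "Im z \<ge> 1 / 2" for z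
    using that order_trans by blast
  thus ?thesis by (intro that[of "\<bar>K\<bar> + 1"]) auto
qed

text \<open>\<open>\<bar>L z\<bar> Im(z)^6\<close> is invariant under translations and under \<open>z \<mapsto> -1/z\<close>; a translation followed by
  an inversion at least doubles the imaginary part as long as it is below \<open>1/2\<close>.\<close>

lemma L_bound:
  obtains C where "C > 0" "\<And>z. Im z > 0 \<Longrightarrow> norm (L z) * Im z ^ 6 \<le> C"
proof -
  obtain K where K: "K > 0" "\<And>z. Im z \<ge> 1 / 2 \<Longrightarrow> norm (L z) \<le> K * exp (- 2 * pi * Im z)"
    by (rule L_exponential_decay) blast
  \<comment> \<open>The factor \<open>6 ^ 6\<close> comes from
    \<open>y / 6 \<le> exp (y / 6)\<close> raised to the sixth power; it lets the exponential decay
    absorb \<open>y ^ 6\<close>.\<close>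
  define C where "C = K * 6 ^ 6"
  have high: "norm (L z) * Im z ^ 6 \<le> C" if z: "Im z \<ge> 1 / 2" for z
  proof -
    define y where "y = Im z"
    have y: "y > 0" using z by (simp add: y_def)
    have "y / 6 \<le> exp (y / 6)" using exp_ge_add_one_self[of "y / 6"] by linarith
    hence "(y / 6) ^ 6 \<le> exp (y / 6) ^ 6" using y by (intro power_mono) auto
    also have "exp (y / 6) ^ 6 = exp y" using exp_of_nat_mult[of 6 "y / 6"] by simp
    also have "\<dots> \<le> exp (2 * pi * y)" using y pi_ge_two by simp
    finally have "y ^ 6 \<le> 6 ^ 6 * exp (2 * pi * y)" by (simp add: power_divide)
    moreover have "norm (L z) \<le> K * exp (- 2 * pi * y)" using K(2)[OF z] by (simp add: y_def)
    ultimately have "norm (L z) * y ^ 6 \<le> (K * exp (- 2 * pi * y)) * (6 ^ 6 * exp (2 * pi * y))"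
      using K(1) y by (intro mult_mono) auto
    also have "\<dots> = C * (exp (- 2 * pi * y) * exp (2 * pi * y))" by (simp only: C_def mult_ac)
    also have "\<dots> = C" by (simp flip: exp_add)
    finally show ?thesis by (simp add: y_def)
  qed
  have "norm (L z) * Im z ^ 6 \<le> C" if "Im z \<ge> 1 / 2 ^ Suc k" for k z
    using that
  proof (induction k arbitrary: z)
    case 0
    thus ?case using high by simp
  next
    case (Suc k)
    show ?case
    proof (cases "Im z \<ge> 1 / 2")
      case False
      \<comment> \<open>Now both coordinates of w are at most 1/2 in absolute value, so
        \<open>(norm w)\<^sup>2 \<le> 1/2\<close>, and the imaginary part of \<open>- 1 / w\<close>,
        which is \<open>Im w / (norm w)\<^sup>2\<close>, is at least
        \<open>2 * Im w\<close>.\<close>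
      define w where "w = z - of_int (round (Re z))"
      have imz: "Im w = Im z" by (simp add: w_def)
      have "Im z \<ge> 1 / 2 ^ Suc (Suc k)" by fact
      moreover have "(0::real) < 1 / 2 ^ Suc (Suc k)" by simp
      ultimately have imp: "Im w > 0" unfolding imz by linarith
      have "\<bar>Re w\<bar> \<le> 1 / 2" using of_int_round_abs_le[of "Re z"] by (simp add: w_def abs_minus_commute)
      hence "\<bar>Re w\<bar>\<^sup>2 \<le> (1 / 2)\<^sup>2" by (intro power_mono) auto
      moreover have "(Im w)\<^sup>2 \<le> (1 / 2)\<^sup>2" using False imp imz by (intro power_mono) auto
      ultimately have w2: "(norm w)\<^sup>2 \<le> 1 / 2" by (simp add: cmod_power2 power_divide)
      have nw: "norm w > 0" using imp by auto
      have im: "Im (- 1 / w) = Im w / (norm w)\<^sup>2" by (simp add: Im_divide cmod_power2)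
      have "Im (- 1 / w) \<ge> Im w / (1 / 2)" unfolding im using w2 nw imp
        by (intro divide_left_mono) auto
      hence "Im (- 1 / w) \<ge> 1 / 2 ^ Suc k" using Suc.prems imz by simp
      hence "norm (L (- 1 / w)) * Im (- 1 / w) ^ 6 \<le> C" by (rule Suc.IH)
      also have "L (- 1 / w) = w ^ 12 * L w" using imp by (rule L_inversion)
      \<comment> \<open>The weight factor \<open>norm w ^ 12\<close> cancels the denominator
        \<open>((norm w)\<^sup>2) ^ 6\<close>.\<close>
      also have "norm (w ^ 12 * L w) * Im (- 1 / w) ^ 6 = norm (L w) * Im w ^ 6"
        unfolding im using nw by (simp add: norm_mult norm_power power_divide flip: power_mult)
      also have "L w = L z" using L_periodic[of w "round (Re z)"] by (simp add: w_def)
      finally show ?thesis by (simp add: imz)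
    qed (rule high)
  qed
  moreover have "\<exists>k. Im z \<ge> 1 / 2 ^ Suc k" if "Im z > 0" for z
  proof -
    obtain k where "(1 / 2) ^ k < Im z" using real_arch_pow_inv[of "Im z" "1 / 2"] \<open>Im z > 0\<close> by auto
    moreover have "(1 / 2 :: real) ^ Suc k \<le> (1 / 2) ^ k" by simp
    ultimately have "1 / 2 ^ Suc k \<le> Im z" by (simp add: power_one_over)
    thus ?thesis by blast
  qed
  ultimately have "norm (L z) * Im z ^ 6 \<le> C" if "Im z > 0" for z using that by blast
  moreover have "C > 0" using K(1) by (simp add: C_def)
  ultimately show ?thesis by (rule that[rotated])
qed

section \<open>Mean squares of the coefficients and the sums of their absolute values\<close>

lemma has_integral_cis_period:
  fixes k :: int
  shows "((\<lambda>t. cis (2 * pi * of_int k * t)) has_integral (if k = 0 then 1 else 0)) {0..1}"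
proof (cases "k = 0")
  case False
  define c where "c = 2 * of_real pi * of_int k * \<i>"
  have c: "c \<noteq> 0" using False by (simp add: c_def)
  have cis: "cis (2 * pi * of_int k * t) = exp (c * of_real t)" for t
    by (simp add: cis_conv_exp c_def mult_ac)
  have "((\<lambda>t. exp (c * of_real t)) has_integral (exp (c * of_real 1) / c - exp (c * of_real 0) / c)) {0..1}"
    using c by (intro fundamental_theorem_of_calculus)
       (auto intro!: derivative_eq_intros has_vector_derivative_real_field)
  moreover have "exp (c * of_real 1) = 1" unfolding c_def by (subst exp_eq_1) auto
  ultimately show ?thesis using False by (simp add: cis)
next
  case True
  thus ?thesis using has_integral_const_real[of "1::complex" 0 1] by simp
qed

text \<open>Orthogonality: in the double sum for \<open>P t * cnj (P t)\<close> only the diagonal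
  terms survive integration over a period.\<close>

lemma trigonometric_polynomial_Parseval:
  fixes b :: "nat \<Rightarrow> complex"
  shows "((\<lambda>t. (norm (\<Sum>n<N. b n * cis (2 * pi * real n * t)))\<^sup>2) has_integral (\<Sum>n<N. (norm (b n))\<^sup>2)) {0..1}"
proof -
  define P where "P t = (\<Sum>n<N. b n * cis (2 * pi * real n * t))" for t
  have "((\<lambda>t. \<Sum>n<N. \<Sum>m<N. b n * cnj (b m) * cis (2 * pi * of_int (int n - int m) * t)) has_integral
          (\<Sum>n<N. \<Sum>m<N. b n * cnj (b m) * (if int n - int m = 0 then 1 else 0))) {0..1}"
    by (intro has_integral_sum has_integral_mult_right has_integral_cis_period) auto
  also have "(\<lambda>t. \<Sum>n<N. \<Sum>m<N. b n * cnj (b m) * cis (2 * pi * of_int (int n - int m) * t)) = (\<lambda>t. of_real ((norm (P t))\<^sup>2))"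
  proof
    fix t
    have "of_real ((norm (P t))\<^sup>2) = P t * cnj (P t)" by (rule complex_norm_square)
    also have "\<dots> = (\<Sum>n<N. \<Sum>m<N. (b n * cis (2 * pi * real n * t)) * (cnj (b m) * cis (- (2 * pi * real m * t))))"
      by (simp add: P_def cnj_sum sum_product cis_cnj)
    also have "\<dots> = (\<Sum>n<N. \<Sum>m<N. b n * cnj (b m) * cis (2 * pi * of_int (int n - int m) * t))"
    proof (intro sum.cong refl)
      fix n m
      have "(b n * cis (2 * pi * real n * t)) * (cnj (b m) * cis (- (2 * pi * real m * t))) =
              b n * cnj (b m) * (cis (2 * pi * real n * t) * cis (- (2 * pi * real m * t)))"
        by (simp only: mult_ac)
      also have "cis (2 * pi * real n * t) * cis (- (2 * pi * real m * t)) = cis (2 * pi * of_int (int n - int m) * t)"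
        unfolding cis_mult by (simp add: algebra_simps)
      finally show "(b n * cis (2 * pi * real n * t)) * (cnj (b m) * cis (- (2 * pi * real m * t))) = b n * cnj (b m) * cis (2 * pi * of_int (int n - int m) * t)" .
    qed
    finally show "(\<Sum>n<N. \<Sum>m<N. b n * cnj (b m) * cis (2 * pi * of_int (int n - int m) * t)) = of_real ((norm (P t))\<^sup>2)" ..
  qed
  also have "(\<Sum>n<N. \<Sum>m<N. b n * cnj (b m) * (if int n - int m = 0 then 1 else 0)) = of_real (\<Sum>n<N. (norm (b n))\<^sup>2)"
    unfolding of_real_sum
  proof (intro sum.cong refl)
    fix n assume "n \<in> {..<N}"
    hence "(\<Sum>m<N. b n * cnj (b m) * (if int n - int m = 0 then 1 else 0)) = b n * cnj (b n)"
      by (subst sum.remove[of _ n]) (auto intro!: sum.neutral)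
    thus "(\<Sum>m<N. b n * cnj (b m) * (if int n - int m = 0 then 1 else 0)) = of_real ((norm (b n))\<^sup>2)"
      by (simp only: complex_norm_square)
  qed
  finally have "((\<lambda>t. complex_of_real ((norm (P t))\<^sup>2)) has_integral of_real (\<Sum>n<N. (norm (b n))\<^sup>2)) {0..1}" .
  from has_integral_linear[OF this bounded_linear_Re] show ?thesis by (simp add: o_def P_def)
qed

text \<open>Truncating where the tail of the absolutely convergent series is below e leaves a
  trigonometric polynomial bounded by B + e, to which the finite Parseval formula applies. Letting e
  tend to 0 removes the error, with no integration of the infinite series.\<close>

lemma coefficient_squares_le:
  fixes b :: "nat \<Rightarrow> complex"
  assumes sb: "summable (\<lambda>n. norm (b n))"
    and bound: "\<And>t. norm (\<Sum>n. b n * cis (2 * pi * real n * t)) \<le> B"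
  shows "(\<Sum>n<N. (norm (b n))\<^sup>2) \<le> B\<^sup>2"
proof -
  have B: "B \<ge> 0" using bound[of 0] norm_ge_zero order_trans by blast
  have main: "(\<Sum>n<N. (norm (b n))\<^sup>2) \<le> (B + e)\<^sup>2" if e: "e > 0" for e
  proof -
    obtain M0 where M0: "\<And>n. n \<ge> M0 \<Longrightarrow> norm (\<Sum>i. norm (b (i + n))) < e"
      using suminf_exist_split[OF e sb] by blast
    define M where "M = max M0 N"
    have pt: "norm (\<Sum>n<M. b n * cis (2 * pi * real n * t)) \<le> B + e" for t
    proof -
      define f where "f n = b n * cis (2 * pi * real n * t)" for n
      have nf: "norm (f n) = norm (b n)" for n by (simp add: f_def norm_mult)
      have sf: "summable f" by (rule summable_norm_cancel) (simp add: nf sb)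
      have "sum f {..<M} = suminf f - (\<Sum>i. f (i + M))" using suminf_minus_initial_segment[OF sf, of M] by simp
      hence "norm (sum f {..<M}) \<le> norm (suminf f) + norm (\<Sum>i. f (i + M))" by (metis norm_triangle_ineq4)
      moreover have "norm (\<Sum>i. f (i + M)) \<le> (\<Sum>i. norm (b (i + M)))"
        using summable_ignore_initial_segment[OF sb, of M] by (intro norm_suminf_le) (auto simp: nf)
      moreover have "(\<Sum>i. norm (b (i + M))) < e" using M0[of M] by (simp add: M_def)
      moreover have "norm (suminf f) \<le> B" using bound by (simp add: f_def[abs_def])
      ultimately show ?thesis by (simp add: f_def)
    qed
    have "(\<Sum>n<N. (norm (b n))\<^sup>2) \<le> (\<Sum>n<M. (norm (b n))\<^sup>2)" by (intro sum_mono2) (auto simp: M_def)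
    also have "\<dots> \<le> (B + e)\<^sup>2"
    proof (rule has_integral_le[OF trigonometric_polynomial_Parseval])
      show "((\<lambda>t::real. (B + e)\<^sup>2) has_integral (B + e)\<^sup>2) {0..1}"
        using has_integral_const_real[of "(B + e)\<^sup>2" 0 1] by simp
    qed (use pt in \<open>auto intro!: power_mono\<close>)
    finally show ?thesis .
  qed
  show ?thesis
  proof (rule tendsto_lowerbound)
    show "((\<lambda>e. (B + e)\<^sup>2) \<longlongrightarrow> B\<^sup>2) (at_right 0)"
      by (auto intro!: tendsto_eq_intros)
    show "\<forall>\<^sub>F e in at_right 0. (\<Sum>n<N. (norm (b n))\<^sup>2) \<le> (B + e)\<^sup>2"
      using main by (auto simp: eventually_at_filter)
  qed auto
qed

lemma sum_norm_ramanujan_tau_le: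
  obtains C where "C > 0" "\<And>N. (\<Sum>n<N. norm (ramanujan_tau n)) \<le> C * real N powr (13/2)"
proof -
  obtain C where C: "C > 0" "\<And>z. Im z > 0 \<Longrightarrow> norm (L z) * Im z ^ 6 \<le> C" by (rule L_bound) blast
  \<comment> \<open>At height 1/N the damping factors \<open>r ^ n\<close> with n < N are at least
    \<open>r ^ N = exp (- (2 * pi))\<close>; the factor \<open>exp (2 * pi)\<close> undoes
    them.\<close>
  define D where "D = C * exp (2 * pi)"
  have "(\<Sum>n<N. norm (ramanujan_tau n)) \<le> D * real N powr (13/2)" for N
  proof (cases "N = 0")
    case False
    define y where "y = 1 / real N"
    have y: "y > 0" using False by (simp add: y_def)
    define r where "r = exp (- 2 * pi * y)"
    have r: "0 < r" "r < 1" using y by (auto simp: r_def)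
    \<comment> \<open>The Fourier coefficients of \<open>L\<close> along the line of height y, on
      which \<open>L_bound\<close> supplies the constant \<open>C / y ^ 6\<close>.\<close>
    define b where "b n = ramanujan_tau n * of_real (r ^ n)" for n
    have nb: "norm (b n) = norm (ramanujan_tau n) * r ^ n" for n
      using r by (simp add: b_def norm_mult norm_power)
    have "(\<Sum>n<N. (norm (b n))\<^sup>2) \<le> (C / y ^ 6)\<^sup>2"
    proof (rule coefficient_squares_le)
      show "summable (\<lambda>n. norm (b n))" unfolding nb using r by (intro norm_ramanujan_tau_summable) auto
      fix t
      define z where "z = Complex t y"
      have "exp (2 * of_real pi * \<i> * z) ^ n = of_real (r ^ n) * cis (2 * pi * real n * t)" for n
      proof -
        have "2 * of_real pi * \<i> * z = of_real (- 2 * pi * y) + \<i> * of_real (2 * pi * t)"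
          by (simp add: z_def complex_eq_iff)
        hence "exp (2 * of_real pi * \<i> * z) = of_real r * cis (2 * pi * t)"
          by (simp only: exp_add exp_of_real r_def cis_conv_exp)
        hence "exp (2 * of_real pi * \<i> * z) ^ n = of_real r ^ n * cis (real n * (2 * pi * t))"
          by (simp only: power_mult_distrib Complex.DeMoivre)
        thus ?thesis by (simp add: mult_ac)
      qed
      moreover have "Im z > 0" using y by (simp add: z_def)
      ultimately have "(\<lambda>n. b n * cis (2 * pi * real n * t)) sums L z"
        using ramanujan_tau_sums[of z] by (simp add: b_def mult.assoc)
      hence "(\<Sum>n. b n * cis (2 * pi * real n * t)) = L z" by (simp add: sums_iff)
      thus "norm (\<Sum>n. b n * cis (2 * pi * real n * t)) \<le> C / y ^ 6"
        using C(2)[of z] y by (simp add: z_def field_simps)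
    qed
    moreover have "r ^ N * norm (ramanujan_tau n) \<le> norm (b n)" if "n < N" for n
    proof -
      have "r ^ N \<le> r ^ n" using r that by (intro power_decreasing) auto
      thus ?thesis unfolding nb using mult_right_mono by (metis mult.commute norm_ge_zero)
    qed
    hence "(\<Sum>n<N. (r ^ N * norm (ramanujan_tau n))\<^sup>2) \<le> (\<Sum>n<N. (norm (b n))\<^sup>2)"
      using r by (intro sum_mono power_mono) auto
    ultimately have sq: "(\<Sum>n<N. (r ^ N * norm (ramanujan_tau n))\<^sup>2) \<le> (C / y ^ 6)\<^sup>2" by linarith
    \<comment> \<open>Cauchy-Schwarz against the constant 1 costs \<open>sqrt N\<close>; together
      with \<open>1 / y ^ 6 = N ^ 6\<close> this makes the exponent 13/2.\<close>
    have "(\<Sum>n<N. (r ^ N * norm (ramanujan_tau n)) * 1) \<le> L2_set (\<lambda>n. r ^ N * norm (ramanujan_tau n)) {..<N} * L2_set (\<lambda>_. 1) {..<N}"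
      using L2_set_mult_ineq[of "\<lambda>n. r ^ N * norm (ramanujan_tau n)" "\<lambda>_. 1" "{..<N}"] r by simp
    also have "\<dots> \<le> (C / y ^ 6) * sqrt (real N)"
    proof (intro mult_mono)
      show "L2_set (\<lambda>n. r ^ N * norm (ramanujan_tau n)) {..<N} \<le> C / y ^ 6"
        unfolding L2_set_def using sq C y by (intro real_le_lsqrt) (auto intro!: sum_nonneg)
      show "L2_set (\<lambda>_. 1) {..<N} \<le> sqrt (real N)" by (simp add: L2_set_def)
    qed (use C y in auto)
    also have "\<dots> = C * real N powr (13/2)"
    proof -
      have "real N powr (13/2) = real N powr (6 + 1/2)" by simp
      also have "\<dots> = real N ^ 6 * sqrt (real N)" using False
        by (simp only: powr_add) (simp add: powr_half_sqrt)
      finally show ?thesis by (simp add: y_def power_divide)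
    qed
    finally have "r ^ N * (\<Sum>n<N. norm (ramanujan_tau n)) \<le> C * real N powr (13/2)"
      by (simp add: sum_distrib_left)
    moreover have "r ^ N = exp (- (2 * pi))"
    proof -
      have "r ^ N = exp (real N * (- 2 * pi * y))" unfolding r_def by (rule exp_of_nat_mult[symmetric])
      thus ?thesis using False by (simp add: y_def)
    qed
    ultimately show ?thesis by (simp add: D_def exp_minus field_simps)
  qed simp
  thus ?thesis using C(1) by (intro that[of D]) (auto simp: D_def)
qed

text \<open>On the dyadic block from \<open>2 ^ k\<close> to \<open>2 ^ Suc k\<close> the factor
  \<open>n powr (- s)\<close> is at most its value at the left end, and the bound on partial sums
  controls the rest. The blocks are then dominated by a geometric series with ratio
  \<open>2 powr (\<alpha> - s) < 1\<close>.\<close>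

lemma summable_Dirichlet:
  fixes a :: "nat \<Rightarrow> real"
  assumes nonneg: "\<And>n. a n \<ge> 0" and C: "\<And>N. (\<Sum>n<N. a n) \<le> C * real N powr \<alpha>"
    and s: "s > \<alpha>" "s > 0"
  shows "summable (\<lambda>n. a (Suc n) * real (Suc n) powr (- s))"
proof -
  have C0: "C \<ge> 0" using C[of 1] nonneg[of 0] by simp
  define \<rho> where "\<rho> = 2 powr (\<alpha> - s)"
  have \<rho>: "0 < \<rho>" "\<rho> < 1" using s by (auto simp: \<rho>_def powr_less_one)
  define f where "f n = a n * real n powr (- s)" for n
  have f0: "f n \<ge> 0" for n using nonneg by (simp add: f_def)
  have dyadic: "(\<Sum>n=2^k..<2^Suc k. f n) \<le> C * 2 powr \<alpha> * \<rho> ^ k" for k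
  proof -
    have "(\<Sum>n=2^k..<2^Suc k. f n) \<le> (\<Sum>n=2^k..<2^Suc k. a n * (2 ^ k) powr (- s))"
    proof (rule sum_mono)
      fix n assume "n \<in> {2^k..<2^Suc k::nat}"
      hence "(2::nat) ^ k \<le> n" by simp
      hence "real (2 ^ k) \<le> real n" by (simp only: of_nat_le_iff)
      hence "real n powr (- s) \<le> (2 ^ k) powr (- s)" using s by (intro powr_mono2') auto
      thus "f n \<le> a n * (2 ^ k) powr (- s)" unfolding f_def by (intro mult_left_mono nonneg)
    qed
    also have "\<dots> = (\<Sum>n=2^k..<2^Suc k. a n) * (2 ^ k) powr (- s)" by (simp only: sum_distrib_right)
    also have "\<dots> \<le> (\<Sum>n<2^Suc k. a n) * (2 ^ k) powr (- s)"
      by (intro mult_right_mono sum_mono2 nonneg) auto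
    also have "\<dots> \<le> (C * real (2 ^ Suc k) powr \<alpha>) * (2 ^ k) powr (- s)"
      by (intro mult_right_mono C) auto
    also have "\<dots> = C * 2 powr \<alpha> * \<rho> ^ k"
    proof -
      have "real (2 ^ Suc k) powr \<alpha> = 2 powr \<alpha> * 2 powr (real k * \<alpha>)"
        by (simp add: powr_mult powr_powr powr_realpow[symmetric])
      moreover have "(2 ^ k :: real) powr (- s) = 2 powr (real k * (- s))"
        by (simp add: powr_powr powr_realpow[symmetric])
      moreover have "\<rho> ^ k = 2 powr (real k * \<alpha>) * 2 powr (real k * (- s))"
        unfolding \<rho>_def by (subst powr_realpow[symmetric]) (simp_all add: powr_powr algebra_simps flip: powr_add)
      ultimately show ?thesis by (simp only: mult_ac)
    qed
    finally show ?thesis .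
  qed
  have part: "(\<Sum>n=1..<2^k. f n) \<le> (\<Sum>j<k. C * 2 powr \<alpha> * \<rho> ^ j)" for k
  proof (induction k)
    case (Suc k)
    have "(\<Sum>n=1..<2^Suc k. f n) = (\<Sum>n=1..<2^k. f n) + (\<Sum>n=2^k..<2^Suc k. f n)"
      by (rule sum.atLeastLessThan_concat[symmetric]) auto
    thus ?case using Suc dyadic[of k] by simp
  qed simp
  have sg: "summable (\<lambda>j. C * 2 powr \<alpha> * \<rho> ^ j)" using \<rho> by (intro summable_mult summable_geometric) auto
  have "summable (\<lambda>n. f (Suc n))"
  proof (rule summableI_nonneg_bounded)
    fix N
    have "(\<Sum>n<N. f (Suc n)) = (\<Sum>n=1..<Suc N. f n)"
      by (simp only: One_nat_def sum.shift_bounds_Suc_ivl atLeast0LessThan)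
    also have "\<dots> \<le> (\<Sum>n=1..<2^N. f n)"
    proof (rule sum_mono2)
      have "Suc N \<le> 2 ^ N" by (simp add: Suc_leI)
      thus "{1..<Suc N} \<subseteq> {1..<2 ^ N}" by auto
    qed (use f0 in auto)
    also have "\<dots> \<le> (\<Sum>j<N. C * 2 powr \<alpha> * \<rho> ^ j)" by (rule part)
    also have "\<dots> \<le> (\<Sum>j. C * 2 powr \<alpha> * \<rho> ^ j)"
      using C0 \<rho> by (intro sum_le_suminf sg) auto
    finally show "(\<Sum>n<N. f (Suc n)) \<le> (\<Sum>j. C * 2 powr \<alpha> * \<rho> ^ j)" .
  qed (rule f0)
  thus ?thesis by (simp add: f_def)
qed

lemma summable_norm_tau_Dirichlet:
  assumes "\<sigma> > 13 / 2"
  shows "summable (\<lambda>n. norm (ramanujan_tau (Suc n)) * real (Suc n) powr (- \<sigma>))"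
proof -
  obtain C where "C > 0" "\<And>N. (\<Sum>n<N. norm (ramanujan_tau n)) \<le> C * real N powr (13/2)"
    by (rule sum_norm_ramanujan_tau_le) blast
  thus ?thesis using assms by (intro summable_Dirichlet[where C = C and \<alpha> = "13/2"]) auto
qed

section \<open>The Mellin transform\<close>

text \<open>Euler's integral for Gamma after the substitution u = a t.\<close>

lemma Mellin_transform_exp:
  fixes a :: real and x :: complex
  assumes a: "a > 0" and x: "Re x > 0"
  shows "(\<lambda>t. exp (of_real (- (a * t))) * of_real t powr (x - 1)) absolutely_integrable_on {0<..}"
    and "integral {0<..} (\<lambda>t. exp (of_real (- (a * t))) * of_real t powr (x - 1)) = Gamma x * of_real a powr (- x)"
proof -
  define f where "f = (\<lambda>u. complex_of_real u powr (x - 1) / of_real (exp u))"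
  define F where "F = (\<lambda>t. exp (complex_of_real (- (a * t))) * of_real t powr (x - 1))"
  have img: "(\<lambda>t. a * t) ` {0<..} = {0<..}"
  proof (intro equalityI subsetI)
    fix u :: real assume "u \<in> {0<..}"
    hence "u = a * (u / a)" "u / a \<in> {0<..}" using a by auto
    thus "u \<in> (\<lambda>t. a * t) ` {0<..}" by blast
  qed (use a in auto)
  have ff: "f absolutely_integrable_on {0<..} \<and> integral {0<..} f = Gamma x"
    unfolding f_def using absolutely_integrable_Gamma_integral'[OF x] Gamma_integral_complex'[OF x]
    by (auto simp: has_integral_iff)
  have "(\<lambda>t. \<bar>a\<bar> *\<^sub>R f (a * t)) absolutely_integrable_on {0<..} \<and> integral {0<..} (\<lambda>t. \<bar>a\<bar> *\<^sub>R f (a * t)) = Gamma x"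
  proof (subst has_absolute_integral_change_of_variables_real)
    show "f absolutely_integrable_on (\<lambda>t. a * t) ` {0<..} \<and> integral ((\<lambda>t. a * t) ` {0<..}) f = Gamma x"
      unfolding img by (rule ff)
  qed (use a in \<open>auto intro!: derivative_eq_intros inj_onI\<close>)
  note cov = this
  have F1: "(\<lambda>t. of_real a powr (- x) * (\<bar>a\<bar> *\<^sub>R f (a * t))) absolutely_integrable_on {0<..}"
    and F2: "integral {0<..} (\<lambda>t. of_real a powr (- x) * (\<bar>a\<bar> *\<^sub>R f (a * t))) = of_real a powr (- x) * Gamma x"
    by (intro set_integrable_mult_right conjunct1[OF cov])
      (simp only: integral_mult_right conjunct2[OF cov])
  have eq: "of_real a powr (- x) * (\<bar>a\<bar> *\<^sub>R f (a * t)) = F t" if "t \<in> {0<..}" for t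
  proof -
    have "complex_of_real (a * t) powr (x - 1) = of_real a powr (x - 1) * of_real t powr (x - 1)"
      using a that by (simp add: powr_times_real)
    moreover have "of_real a powr (- x) * of_real a powr (x - 1) * of_real a = (1 :: complex)"
    proof -
      have "of_real a powr (- x) * of_real a powr (x - 1) * complex_of_real a powr 1 = of_real a powr (- x + (x - 1) + 1)"
        by (simp only: powr_add)
      thus ?thesis using a by simp
    qed
    moreover have "of_real a powr (- x) * (\<bar>a\<bar> *\<^sub>R f (a * t)) =
        of_real a powr (- x) * (of_real a * (complex_of_real (a * t) powr (x - 1) / of_real (exp (a * t))))"
      using a by (simp add: f_def scaleR_conv_of_real)
    ultimately have "of_real a powr (- x) * (\<bar>a\<bar> *\<^sub>R f (a * t)) = of_real t powr (x - 1) / of_real (exp (a * t))"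
      by (simp add: field_simps)
    thus ?thesis by (simp add: F_def exp_of_real[symmetric] exp_minus field_simps)
  qed
  show "F absolutely_integrable_on {0<..}"
    by (rule set_integrable_cong[THEN iffD1, OF refl refl _ F1]) (use eq in auto)
  show "integral {0<..} F = Gamma x * of_real a powr (- x)"
  proof -
    have "integral {0<..} F = integral {0<..} (\<lambda>t. of_real a powr (- x) * (\<bar>a\<bar> *\<^sub>R f (a * t)))"
      by (rule sym, rule Henstock_Kurzweil_Integration.integral_cong, rule eq)
    thus ?thesis unfolding F2 by (simp only: mult.commute)
  qed
qed

text \<open>The norm of the integrand is the same integrand at the real exponent
  \<open>Re x\<close>, so the previous lemma evaluates it. These L1 norms justify integrating the
  q-series term by term.\<close>

lemma norm_Mellin_transform_exp:
  fixes a :: real and x :: complex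
  assumes a: "a > 0" and x: "Re x > 0"
  shows "integral {0<..} (\<lambda>t. norm (exp (of_real (- (a * t))) * complex_of_real t powr (x - 1))) = Gamma (Re x) * a powr (- Re x)"
proof -
  define F where "F = (\<lambda>t. norm (exp (of_real (- (a * t))) * complex_of_real t powr (x - 1)))"
  have "integral {0<..} (\<lambda>t. complex_of_real (F t)) =
        integral {0<..} (\<lambda>t. exp (of_real (- (a * t))) * of_real t powr (of_real (Re x) - 1))"
  proof (rule Henstock_Kurzweil_Integration.integral_cong)
    fix t :: real assume "t \<in> {0<..}"
    hence t: "t > 0" by simp
    have e: "exp (complex_of_real (- (a * t))) = of_real (exp (- (a * t)))" by (rule exp_of_real)
    have "F t = exp (- (a * t)) * t powr (Re x - 1)"
      unfolding F_def e using t by (simp add: norm_mult norm_powr_real_powr)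
    thus "complex_of_real (F t) = exp (of_real (- (a * t))) * of_real t powr (of_real (Re x) - 1)"
      unfolding e using t by (simp add: powr_of_real[symmetric])
  qed
  also have "\<dots> = of_real (Gamma (Re x) * a powr (- Re x))"
    using Mellin_transform_exp(2)[of a "of_real (Re x)"] a x
    by (simp add: Gamma_complex_of_real powr_of_real[symmetric])
  finally have "integral {0<..} (\<lambda>t. complex_of_real (F t)) = of_real (Gamma (Re x) * a powr (- Re x))" .
  moreover have "F integrable_on {0<..}" unfolding F_def
    by (intro set_lebesgue_integral_eq_integral(1) set_integrable_norm Mellin_transform_exp(1) a x)
  hence "((\<lambda>t. complex_of_real (F t)) has_integral of_real (integral {0<..} F)) {0<..}"
    using has_integral_linear[OF integrable_integral bounded_linear_of_real] by (simp add: o_def)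
  hence "integral {0<..} (\<lambda>t. complex_of_real (F t)) = of_real (integral {0<..} F)" by (rule integral_unique)
  ultimately show ?thesis by (simp only: of_real_eq_iff F_def)
qed

text \<open>The q-series is integrated term by term. This is legitimate because the L1 norms of the
  terms add up to a constant times the Dirichlet series of \<open>norm (ramanujan_tau n)\<close> at
  \<open>Re x\<close>, which converges beyond 13/2. Dividing by Gamma through the entire
  \<open>rGamma\<close> gives a formula that can be continued as it stands.\<close>

lemma Mellin_transform_L:
  assumes x: "Re x > 13 / 2"
  shows "(\<lambda>t. L (\<i> * of_real t) * of_real t powr (x - 1)) absolutely_integrable_on {0<..}"
    and "(\<lambda>n. ramanujan_tau (Suc n) * of_nat (Suc n) powr (- x)) sums
           (of_real (2 * pi) powr x * rGamma x * integral {0<..} (\<lambda>t. L (\<i> * of_real t) * of_real t powr (x - 1)))"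
proof -
  define a where "a n = 2 * pi * real (Suc n)" for n
  have a: "a n > 0" for n by (simp add: a_def)
  have x0: "Re x > 0" using x by simp
  define G where "G n t = ramanujan_tau (Suc n) * (exp (of_real (- (a n * t))) * complex_of_real t powr (x - 1))" for n t
  define f where "f n t = indicator {0<..} t *\<^sub>R G n t" for n t
  have Gai: "G n absolutely_integrable_on {0<..}" for n
    unfolding G_def using Mellin_transform_exp(1)[OF a x0] by (intro set_integrable_mult_right)
  have fint: "integrable lebesgue (f n)" for n
    using Gai[of n] by (simp add: set_integrable_def f_def[abs_def])
  have fval: "integral\<^sup>L lebesgue (f n) = ramanujan_tau (Suc n) * (Gamma x * of_real (a n) powr (- x))" for n
  proof -
    have "integral\<^sup>L lebesgue (f n) = integral {0<..} (G n)"
      using set_lebesgue_integral_eq_integral(2)[OF Gai[of n]] by (simp add: set_lebesgue_integral_def f_def[abs_def])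
    also have "\<dots> = ramanujan_tau (Suc n) * (Gamma x * of_real (a n) powr (- x))"
      unfolding G_def integral_mult_right Mellin_transform_exp(2)[OF a x0] ..
    finally show ?thesis .
  qed
  have fnorm: "(\<integral>t. norm (f n t) \<partial>lebesgue) = norm (ramanujan_tau (Suc n)) * (Gamma (Re x) * a n powr (- Re x))" for n
  proof -
    have "(\<lambda>t. norm (G n t)) absolutely_integrable_on {0<..}" using Gai[of n] by (rule set_integrable_norm)
    from set_lebesgue_integral_eq_integral(2)[OF this]
    have "(\<integral>t. norm (f n t) \<partial>lebesgue) = integral {0<..} (\<lambda>t. norm (G n t))"
      by (simp add: set_lebesgue_integral_def f_def[abs_def])
    also have "\<dots> = norm (ramanujan_tau (Suc n)) * (Gamma (Re x) * a n powr (- Re x))"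
      unfolding G_def norm_mult[of "ramanujan_tau _"] integral_mult_right norm_Mellin_transform_exp[OF a x0] ..
    finally show ?thesis .
  qed
  have Lsum: "(\<lambda>n. G n t) sums (L (\<i> * of_real t) * of_real t powr (x - 1))" if t: "t > 0" for t
  proof -
    have "(\<lambda>m. ramanujan_tau m * exp (2 * of_real pi * \<i> * (\<i> * of_real t)) ^ m) sums L (\<i> * of_real t)"
      using t by (intro ramanujan_tau_sums) simp
    hence "(\<lambda>m. ramanujan_tau (Suc m) * exp (2 * of_real pi * \<i> * (\<i> * of_real t)) ^ Suc m) sums L (\<i> * of_real t)"
      by (subst sums_Suc_iff) (simp add: ramanujan_tau_0)
    moreover have "exp (2 * of_real pi * \<i> * (\<i> * of_real t)) ^ Suc m = exp (of_real (- (a m * t)))" for m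
    proof -
      have "exp (2 * of_real pi * \<i> * (\<i> * of_real t)) ^ Suc m = exp (of_nat (Suc m) * (2 * of_real pi * \<i> * (\<i> * of_real t)))"
        by (rule exp_of_nat_mult[symmetric])
      also have "of_nat (Suc m) * (2 * of_real pi * \<i> * (\<i> * of_real t)) = (of_real (- (a m * t)) :: complex)"
        by (simp add: a_def algebra_simps)
      finally show ?thesis .
    qed
    ultimately have "(\<lambda>m. ramanujan_tau (Suc m) * exp (of_real (- (a m * t)))) sums L (\<i> * of_real t)" by simp
    from sums_mult2[OF this, of "of_real t powr (x - 1)"] show ?thesis by (simp add: G_def mult.assoc)
  qed
  have AE: "AE t in lebesgue. summable (\<lambda>n. norm (f n t))"
  proof (rule AE_I2)
    fix t :: real
    show "summable (\<lambda>n. norm (f n t))"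
    proof (cases "t > 0")
      case True
      define r where "r = exp (- (2 * pi * t))"
      have r: "0 \<le> r" "r < 1" using True by (auto simp: r_def)
      have "norm (exp (complex_of_real (- (a n * t)))) = r ^ Suc n" for n
      proof -
        have "r ^ Suc n = exp (real (Suc n) * (- (2 * pi * t)))" unfolding r_def by (rule exp_of_nat_mult[symmetric])
        thus ?thesis by (simp add: a_def mult_ac)
      qed
      hence "norm (f n t) = norm (ramanujan_tau (Suc n)) * r ^ Suc n * norm (complex_of_real t powr (x - 1))" for n
        using True by (simp add: f_def G_def norm_mult)
      moreover have "summable (\<lambda>n. norm (ramanujan_tau (Suc n)) * r ^ Suc n)"
        using norm_ramanujan_tau_summable[OF r] by (subst summable_Suc_iff)
      ultimately show ?thesis using summable_mult2 by auto
    qed (simp add: f_def)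
  qed
  have snorm: "summable (\<lambda>n. \<integral>t. norm (f n t) \<partial>lebesgue)"
  proof -
    have "summable (\<lambda>n. Gamma (Re x) * (2 * pi) powr (- Re x) * (norm (ramanujan_tau (Suc n)) * real (Suc n) powr (- Re x)))"
      using x by (intro summable_mult summable_norm_tau_Dirichlet)
    moreover have "a n powr (- Re x) = (2 * pi) powr (- Re x) * real (Suc n) powr (- Re x)" for n
      unfolding a_def by (rule powr_mult)
    ultimately show ?thesis unfolding fnorm by (simp add: mult_ac)
  qed
  have lim: "(\<Sum>n. f n t) = indicator {0<..} t *\<^sub>R (L (\<i> * of_real t) * of_real t powr (x - 1))" for t
    using Lsum[of t] by (cases "t > 0") (auto simp: f_def sums_iff)
  have "integrable lebesgue (\<lambda>t. \<Sum>n. f n t)"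
    by (rule integrable_suminf[OF fint AE snorm])
  thus ai: "(\<lambda>t. L (\<i> * of_real t) * of_real t powr (x - 1)) absolutely_integrable_on {0<..}"
    by (simp add: set_integrable_def lim)
  define I where "I = integral {0<..} (\<lambda>t. L (\<i> * of_real t) * of_real t powr (x - 1))"
  have "(\<lambda>n. integral\<^sup>L lebesgue (f n)) sums (\<integral>t. (\<Sum>n. f n t) \<partial>lebesgue)"
    by (rule sums_integral[OF fint AE snorm])
  also have "(\<integral>t. (\<Sum>n. f n t) \<partial>lebesgue) = I"
    using set_lebesgue_integral_eq_integral(2)[OF ai] by (simp add: lim set_lebesgue_integral_def I_def)
  finally have "(\<lambda>n. ramanujan_tau (Suc n) * (Gamma x * of_real (a n) powr (- x))) sums I"
    unfolding fval .
  from sums_mult[OF this, of "of_real (2 * pi) powr x * rGamma x"]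
  have "(\<lambda>n. of_real (2 * pi) powr x * rGamma x * (ramanujan_tau (Suc n) * (Gamma x * of_real (a n) powr (- x)))) sums
          (of_real (2 * pi) powr x * rGamma x * I)" .
  moreover have "of_real (2 * pi) powr x * rGamma x * (ramanujan_tau (Suc n) * (Gamma x * of_real (a n) powr (- x))) =
       ramanujan_tau (Suc n) * of_nat (Suc n) powr (- x)" for n
  proof -
    have a_powr: "complex_of_real (a n) powr (- x) = of_real (2 * pi) powr (- x) * of_real (real (Suc n)) powr (- x)"
      unfolding a_def of_real_mult[of "2 * pi"] by (rule powr_times_real) auto
    have one1: "of_real (2 * pi) powr x * of_real (2 * pi) powr (- x) = (1 :: complex)"
      by (simp add: powr_minus)
    have "x \<notin> \<int>\<^sub>\<le>\<^sub>0" using x0 by (auto elim!: nonpos_Ints_cases)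
    hence one2: "rGamma x * Gamma x = 1" by (simp add: rGamma_inverse_Gamma Gamma_eq_zero_iff)
    have "of_real (2 * pi) powr x * rGamma x * (ramanujan_tau (Suc n) * (Gamma x * of_real (a n) powr (- x))) =
            (of_real (2 * pi) powr x * of_real (2 * pi) powr (- x)) * (rGamma x * Gamma x) *
            (ramanujan_tau (Suc n) * of_real (real (Suc n)) powr (- x))"
      unfolding a_powr by (simp only: mult_ac)
    thus ?thesis unfolding one1 one2 by simp
  qed
  ultimately show "(\<lambda>n. ramanujan_tau (Suc n) * of_nat (Suc n) powr (- x)) sums
           (of_real (2 * pi) powr x * rGamma x * integral {0<..} (\<lambda>t. L (\<i> * of_real t) * of_real t powr (x - 1)))"
    by (simp only: I_def)
qed

text \<open>The substitution t to 1/t carries \<open>{1..}\<close> to \<open>{0<..1}\<close>, and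
  the modular relation turns \<open>t powr (1 - x) / t\<^sup>2\<close> into
  \<open>t powr (12 - x - 1)\<close>. As \<open>Re x\<close> may be arbitrarily large, the second
  claim also shows that \<open>L (\<i> t)\<close> is integrable near 0 against every negative power
  of t.\<close>

lemma Mellin_transform_L_fold:
  assumes x: "Re x > 13 / 2"
  defines "F \<equiv> (\<lambda>y t. L (\<i> * of_real t) * complex_of_real t powr (y - 1))"
  shows "F x absolutely_integrable_on {0<..1}"
    and "F (12 - x) absolutely_integrable_on {0<..1}"
    and "integral {0<..} (F x) = integral {0<..1} (F x) + integral {0<..1} (F (12 - x))"
proof -
  have ai: "F x absolutely_integrable_on {0<..}" using Mellin_transform_L(1)[OF x] by (simp add: F_def)
  have sub: "F x absolutely_integrable_on S" if "S \<subseteq> {0<..}" "S \<in> sets lebesgue" for S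
    using set_integrable_subset[OF ai] that by blast
  show a1: "F x absolutely_integrable_on {0<..1}" by (rule sub) auto
  have a2: "F x absolutely_integrable_on {1..}" by (rule sub) auto
  have img: "(\<lambda>t. 1 / t) ` {0<..1} = ({1..} :: real set)"
  proof (intro equalityI subsetI)
    fix u :: real assume "u \<in> {1..}"
    hence "u = 1 / (1 / u)" "1 / u \<in> {0<..1}" by auto
    thus "u \<in> (\<lambda>t. 1 / t) ` {0<..1}" by blast
  qed auto
  have cov: "(\<lambda>t. \<bar>- (1 / t\<^sup>2)\<bar> *\<^sub>R F x (1 / t)) absolutely_integrable_on {0<..1} \<and>
        integral {0<..1} (\<lambda>t. \<bar>- (1 / t\<^sup>2)\<bar> *\<^sub>R F x (1 / t)) = integral {1..} (F x)"
  proof (subst has_absolute_integral_change_of_variables_real)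
    show "F x absolutely_integrable_on (\<lambda>t. 1 / t) ` {0<..1} \<and> integral ((\<lambda>t. 1 / t) ` {0<..1}) (F x) = integral {1..} (F x)"
      unfolding img using a2 by simp
  qed (auto intro!: derivative_eq_intros inj_onI simp: power2_eq_square)
  have eq: "\<bar>- (1 / t\<^sup>2)\<bar> *\<^sub>R F x (1 / t) = F (12 - x) t" if "t \<in> {0<..1}" for t
  proof -
    have t: "t > 0" using that by simp
    have L: "L (\<i> * of_real (1 / t)) = of_real (t ^ 12) * L (\<i> * of_real t)"
      by (rule L_inversion_imaginary_axis[OF t])
    have "complex_of_real (1 / t) powr (x - 1) = of_real t powr (1 - x)"
    proof -
      have "complex_of_real (1 / t) powr (x - 1) = inverse (of_real t) powr (x - 1)" by (simp add: inverse_eq_divide)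
      also have "\<dots> = of_real t powr (1 - x)"
        using t by (simp add: powr_def Ln_of_real exp_minus ln_div flip: of_real_inverse) (simp add: ln_inverse algebra_simps)
      finally show ?thesis .
    qed
    moreover have "complex_of_real (1 / t\<^sup>2) * of_real (t ^ 12) = of_real t powr 10"
      using t by (simp add: powr_numeral) (simp add: field_simps power_add[symmetric] flip: power_add)
    moreover have "complex_of_real t powr 10 * of_real t powr (1 - x) = of_real t powr (12 - x - 1)"
    proof -
      have "10 + (1 - x) = 12 - x - 1" by simp
      thus ?thesis by (metis powr_add)
    qed
    moreover have "\<bar>- (1 / t\<^sup>2)\<bar> *\<^sub>R F x (1 / t) = L (\<i> * of_real t) *
        ((complex_of_real (1 / t\<^sup>2) * of_real (t ^ 12)) * complex_of_real (1 / t) powr (x - 1))"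
      unfolding F_def L scaleR_conv_of_real abs_minus_cancel using t by (simp only: mult_ac abs_of_pos) simp
    ultimately show ?thesis by (simp add: F_def)
  qed
  show a3: "F (12 - x) absolutely_integrable_on {0<..1}"
    by (rule set_integrable_cong[THEN iffD1, OF refl refl _ conjunct1[OF cov]]) (use eq in auto)
  have "integral {0<..1} (F (12 - x)) = integral {1..} (F x)"
  proof -
    have "integral {0<..1} (F (12 - x)) = integral {0<..1} (\<lambda>t. \<bar>- (1 / t\<^sup>2)\<bar> *\<^sub>R F x (1 / t))"
      by (rule sym, rule Henstock_Kurzweil_Integration.integral_cong, rule eq)
    thus ?thesis using cov by simp
  qed
  moreover have "integral ({0<..1} \<union> {1..}) (F x) = integral {0<..1} (F x) + integral {1..} (F x)"
  proof (rule integral_Un)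
    have "{0<..1} \<inter> {1..} = {1::real}" by auto
    thus "negligible ({0<..1} \<inter> ({1..} :: real set))" by simp
  qed (use a1 a2 set_lebesgue_integral_eq_integral(1) in auto)
  moreover have "{0<..1} \<union> {1..} = ({0<..} :: real set)" by auto
  ultimately show "integral {0<..} (F x) = integral {0<..1} (F x) + integral {0<..1} (F (12 - x))" by simp
qed

section \<open>The power series and the entire continuation\<close>

text \<open>The powers of t with exponents z and -z are written as exponentials of
  \<open>z * ln t\<close>, ready for expansion in powers of z.\<close>

definition Xi_integrand :: "complex \<Rightarrow> real \<Rightarrow> complex" where
  "Xi_integrand z t = L (\<i> * of_real t) * of_real (t ^ 5) * (exp (z * of_real (ln t)) + exp (- (z * of_real (ln t))))"

definition Xi_integral :: "complex \<Rightarrow> complex" where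
  "Xi_integral z = integral {0<..1} (Xi_integrand z)"

text \<open>The cut keeps only arguments in the upper half-plane, where \<open>L\<close> is
  continuous, so the function is Borel measurable on the whole line.\<close>

definition L_cut :: "real \<Rightarrow> complex" where
  "L_cut t = indicator {0<..1} t *\<^sub>R L (\<i> * of_real t)"

lemma L_cut_measurable [measurable]: "L_cut \<in> borel_measurable borel"
proof -
  have "continuous_on {0<..1} (\<lambda>t. L (\<i> * complex_of_real t))"
    by (rule continuous_on_compose2[OF holomorphic_on_imp_continuous_on[OF L_holomorphic]])
       (auto intro!: continuous_intros)
  thus ?thesis unfolding L_cut_def[abs_def]
    by (intro borel_measurable_continuous_on_indicator) auto
qed

text \<open>This is the folded Mellin integrand at \<open>x = 7 + R\<close>, where
  \<open>12 - x - 1 = 4 - R\<close>. It supplies the majorants for the integrals below.\<close>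

lemma integrable_L_cut_powr:
  assumes R: "R \<ge> 0"
  shows "integrable lborel (\<lambda>t. norm (L_cut t) * t powr (4 - R))"
proof -
  define x :: complex where "x = of_real (7 + R)"
  have "Re x > 13 / 2" using R by (simp add: x_def)
  from set_integrable_norm[OF Mellin_transform_L_fold(2)[OF this]]
  have "integrable lebesgue (\<lambda>t. indicator {0<..1} t *\<^sub>R norm (L (\<i> * of_real t) * complex_of_real t powr (12 - x - 1)))"
    by (simp add: set_integrable_def)
  also have "(\<lambda>t. indicator {0<..1} t *\<^sub>R norm (L (\<i> * of_real t) * complex_of_real t powr (12 - x - 1))) =
             (\<lambda>t. norm (L_cut t) * t powr (4 - R))"
    by (auto simp: fun_eq_iff indicator_def L_cut_def norm_mult norm_powr_real_powr x_def algebra_simps)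
  finally show ?thesis by (subst (asm) integrable_completion) measurable
qed

lemma exp_series_even:
  fixes u :: "'a :: {real_normed_field, banach}"
  shows "(\<lambda>k. 2 * (u ^ (2 * k) / fact (2 * k))) sums (exp u + exp (- u))"
proof -
  have "(\<lambda>n. u ^ n /\<^sub>R fact n + (- u) ^ n /\<^sub>R fact n) sums (exp u + exp (- u))"
    by (intro sums_add exp_converges)
  also have "(\<lambda>n. u ^ n /\<^sub>R fact n + (- u) ^ n /\<^sub>R fact n) = (\<lambda>n. if even n then 2 * (u ^ n / fact n) else 0)"
    by (auto simp: fun_eq_iff scaleR_conv_of_real field_simps)
  finally have "(\<lambda>k. if even (2 * k) then 2 * (u ^ (2 * k) / fact (2 * k)) else 0) sums (exp u + exp (- u))"
    by (subst sums_mono_reindex[where g = "\<lambda>k. 2 * k"]) (auto simp: strict_mono_def elim!: evenE)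
  thus ?thesis by simp
qed

text \<open>Taking norms termwise replaces \<open>z * ln t\<close> by
  \<open>norm z * \<bar>ln t\<bar>\<close>, and nonnegative partial sums stay below the full series
  for twice the hyperbolic cosine. As \<open>t \<le> 1\<close>,
  \<open>exp (norm z * \<bar>ln t\<bar>)\<close> is \<open>t powr (- norm z)\<close>; the bound does
  not depend on N.\<close>

lemma even_exp_partial_sum_le:
  assumes t: "0 < t" "t \<le> 1"
  shows "norm (\<Sum>k<N. 2 * ((z * complex_of_real (ln t)) ^ (2 * k) / fact (2 * k))) \<le> 2 * t powr (- norm z)"
proof -
  define r where "r = norm z * \<bar>ln t\<bar>"
  have r: "r \<ge> 0" by (simp add: r_def)
  have "norm (\<Sum>k<N. 2 * ((z * complex_of_real (ln t)) ^ (2 * k) / fact (2 * k))) \<le>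
          (\<Sum>k<N. norm (2 * ((z * complex_of_real (ln t)) ^ (2 * k) / fact (2 * k))))"
    by (rule norm_sum)
  also have "\<dots> = (\<Sum>k<N. 2 * (r ^ (2 * k) / fact (2 * k)))"
    by (simp add: norm_mult norm_power norm_divide r_def)
  also have "\<dots> \<le> exp r + exp (- r)"
    using exp_series_even[of r] r sum_le_suminf[of "\<lambda>k. 2 * (r ^ (2 * k) / fact (2 * k))" "{..<N}"]
    by (simp add: sums_iff)
  also have "\<dots> \<le> 2 * exp r" using r by simp
  also have "exp r = t powr (- norm z)" using t by (simp add: r_def powr_def)
  finally show ?thesis .
qed

lemma chi_integrand:
  "integrable lborel (\<lambda>t. L_cut t * of_real (t ^ 5 * (ln t ^ (2 * s) / fact (2 * s))))"
  "chi s = 2 * (\<integral>t. L_cut t * of_real (t ^ 5 * (ln t ^ (2 * s) / fact (2 * s))) \<partial>lborel)"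
proof -
  \<comment> \<open>\<open>chi\<close> integrates over the closed interval while
    \<open>L_cut\<close> vanishes at 0; the factor \<open>w ^ 5\<close> makes both integrands 0
    there.\<close>
  have "indicator {0..1} w *\<^sub>R (L (\<i> * of_real w) * of_real (w ^ 5 * (ln w ^ (2 * s) / fact (2 * s)))) =
        L_cut w * of_real (w ^ 5 * (ln w ^ (2 * s) / fact (2 * s)))" for w
    by (cases "w = 0") (auto simp: L_cut_def indicator_def)
  thus "chi s = 2 * (\<integral>t. L_cut t * of_real (t ^ 5 * (ln t ^ (2 * s) / fact (2 * s))) \<partial>lborel)"
    by (simp only: chi_def set_lebesgue_integral_def)
  show "integrable lborel (\<lambda>t. L_cut t * of_real (t ^ 5 * (ln t ^ (2 * s) / fact (2 * s))))"
  proof (rule Bochner_Integration.integrable_bound)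
    \<comment> \<open>The case R = 1. The logarithmic factor is at most
      \<open>exp (ln t) + exp (- ln t) = t + 1 / t \<le> 2 / t\<close>, which turns
      \<open>t ^ 5\<close> into \<open>2 * t ^ 4\<close>, at most \<open>2 * t ^ 3\<close>.\<close>
    show "integrable lborel (\<lambda>t. 2 * (norm (L_cut t) * t powr (4 - 1)))"
      by (intro integrable_mult_right integrable_L_cut_powr) auto
    show "AE t in lborel. norm (L_cut t * of_real (t ^ 5 * (ln t ^ (2 * s) / fact (2 * s)))) \<le> norm (2 * (norm (L_cut t) * t powr (4 - 1)))"
    proof (rule AE_I2)
      fix t :: real
      show "norm (L_cut t * of_real (t ^ 5 * (ln t ^ (2 * s) / fact (2 * s)))) \<le> norm (2 * (norm (L_cut t) * t powr (4 - 1)))"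
      proof (cases "t \<in> {0<..1}")
        case True
        hence t: "0 < t" "t \<le> 1" by auto
        define v where "v = ln t ^ (2 * s) / fact (2 * s)"
        have v0: "v \<ge> 0" by (simp add: v_def)
        have "v \<le> exp (ln t) + exp (- ln t)"
        proof -
          have "(\<Sum>k\<in>{s}. 2 * (ln t ^ (2 * k) / fact (2 * k))) \<le> (\<Sum>k. 2 * (ln t ^ (2 * k) / fact (2 * k)))"
            using exp_series_even[of "ln t"] by (intro sum_le_suminf) (auto simp: sums_iff)
          hence "2 * v \<le> exp (ln t) + exp (- ln t)" using exp_series_even[of "ln t"] by (simp add: sums_iff v_def)
          thus ?thesis using v0 by linarith
        qed
        also have "\<dots> = t + 1 / t" using t by (simp add: exp_minus inverse_eq_divide)
        also have "\<dots> \<le> 2 / t" using t by (simp add: field_simps) (use mult_le_one[of t t] in simp)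
        finally have "t ^ 5 * v \<le> t ^ 5 * (2 / t)" using t by (intro mult_left_mono) auto
        also have "\<dots> = 2 * t ^ 4" using t by (simp add: field_simps power_numeral_reduce)
        also have "\<dots> \<le> 2 * t powr (4 - 1)" using t by (simp add: power_decreasing)
        finally have "t ^ 5 * v \<le> 2 * t powr (4 - 1)" .
        hence "norm (L_cut t) * (t ^ 5 * v) \<le> norm (L_cut t) * (2 * t powr (4 - 1))" by (intro mult_left_mono) auto
        moreover have "norm (L_cut t * of_real (t ^ 5 * v)) = norm (L_cut t) * (t ^ 5 * v)"
          using t v0 by (simp add: norm_mult norm_power)
        ultimately show ?thesis using t by (simp add: v_def mult_ac)
      qed (simp add: L_cut_def)
    qed
  qed measurable
qed

lemma chi_sums_Xi_integral:
  shows "(\<lambda>s. chi s * z ^ (2 * s)) sums Xi_integral z"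
    and "Xi_integrand z absolutely_integrable_on {0<..1}"
proof -
  define T where "T k t = L_cut t * of_real (t ^ 5 * (ln t ^ (2 * k) / fact (2 * k)))" for k t
  define S where "S N t = (\<Sum>k<N. 2 * z ^ (2 * k) * T k t)" for N t
  define f where "f t = L_cut t * of_real (t ^ 5) * (exp (z * of_real (ln t)) + exp (- (z * of_real (ln t))))" for t
  \<comment> \<open>A majorant for all partial sums at once. One factor t of \<open>t ^ 5\<close> is
    given up, which is allowed as \<open>t \<le> 1\<close>, so that it is
    \<open>integrable_L_cut_powr\<close> with \<open>R = norm z\<close>.\<close>
  define w where "w t = 2 * (norm (L_cut t) * t powr (4 - norm z))" for t
  have S_eq: "S N t = L_cut t * of_real (t ^ 5) * (\<Sum>k<N. 2 * ((z * of_real (ln t)) ^ (2 * k) / fact (2 * k)))" for N t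
    by (simp add: S_def T_def sum_distrib_left power_mult_distrib mult_ac)
  have wint: "integrable lborel w" unfolding w_def by (intro integrable_mult_right integrable_L_cut_powr) auto
  have [measurable]: "f \<in> borel_measurable lborel" "S N \<in> borel_measurable lborel" for N
    unfolding f_def S_def T_def by measurable
  have lim: "AE t in lborel. (\<lambda>N. S N t) \<longlonglongrightarrow> f t"
    unfolding S_eq f_def using exp_series_even by (intro AE_I2 tendsto_intros) (simp add: sums_def)
  have bound: "AE t in lborel. norm (S N t) \<le> w t" for N
  proof (rule AE_I2)
    fix t :: real
    show "norm (S N t) \<le> w t"
    proof (cases "t \<in> {0<..1}")
      case True
      hence t: "0 < t" "t \<le> 1" by auto
      have "norm (S N t) = norm (L_cut t) * (t ^ 5 * norm (\<Sum>k<N. 2 * ((z * complex_of_real (ln t)) ^ (2 * k) / fact (2 * k))))"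
        unfolding S_eq using t by (simp add: norm_mult norm_power)
      also have "\<dots> \<le> norm (L_cut t) * (t ^ 5 * (2 * t powr (- norm z)))"
        using t by (intro mult_left_mono even_exp_partial_sum_le) auto
      also have "\<dots> \<le> norm (L_cut t) * (t ^ 4 * (2 * t powr (- norm z)))"
        using t by (intro mult_left_mono mult_right_mono power_decreasing) auto
      also have "\<dots> = w t"
      proof -
        have "t powr (4 - norm z) = t powr 4 * t powr (- norm z)" by (simp flip: powr_add)
        also have "t powr 4 = t ^ 4" using t by simp
        finally show ?thesis by (simp add: w_def)
      qed
      finally show ?thesis .
    qed (simp add: S_eq w_def L_cut_def)
  qed
  have fint: "integrable lborel f"
    by (rule integrable_dominated_convergence[OF _ _ wint lim bound]) measurable
  have flim: "(\<lambda>N. integral\<^sup>L lborel (S N)) \<longlonglongrightarrow> integral\<^sup>L lborel f"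
    by (rule integral_dominated_convergence[OF _ _ wint lim bound]) measurable
  have Sint: "integral\<^sup>L lborel (S N) = (\<Sum>k<N. chi k * z ^ (2 * k))" for N
  proof -
    have "integral\<^sup>L lborel (S N) = (\<Sum>k<N. integral\<^sup>L lborel (\<lambda>t. 2 * z ^ (2 * k) * T k t))"
      unfolding S_def T_def using chi_integrand(1)
      by (intro Bochner_Integration.integral_sum integrable_mult_right)
    also have "\<dots> = (\<Sum>k<N. chi k * z ^ (2 * k))"
      by (intro sum.cong refl) (simp add: T_def chi_integrand(2))
    finally show ?thesis .
  qed
  have f_eq: "f = (\<lambda>t. indicator {0<..1} t *\<^sub>R Xi_integrand z t)"
    by (simp add: fun_eq_iff f_def L_cut_def Xi_integrand_def)
  have si: "set_integrable lborel {0<..1} (Xi_integrand z)"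
    using fint by (simp add: set_integrable_def f_eq)
  have "integral\<^sup>L lborel f = Xi_integral z"
    using set_borel_integral_eq_integral(2)[OF si] by (simp add: Xi_integral_def f_eq set_lebesgue_integral_def)
  thus "(\<lambda>s. chi s * z ^ (2 * s)) sums Xi_integral z"
    using flim by (simp add: Sint sums_def)
  show "Xi_integrand z absolutely_integrable_on {0<..1}"
  proof -
    have "f \<in> borel_measurable lborel" by measurable
    thus ?thesis using fint by (simp add: set_integrable_def f_eq integrable_completion)
  qed
qed

text \<open>The expansion is a power series \<open>G\<close> in \<open>z\<^sup>2\<close>. Evaluating
  it at \<open>csqrt w\<close> shows that \<open>G\<close> converges at every w, so \<open>G\<close>
  is entire and so is its composition with the square.\<close>

lemma Xi_integral_holomorphic: "Xi_integral holomorphic_on UNIV"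
proof -
  define G where "G w = (\<Sum>s. chi s * w ^ s)" for w
  have G: "(\<lambda>s. chi s * w ^ s) sums G w" for w
  proof -
    have "(\<lambda>s. chi s * csqrt w ^ (2 * s)) sums Xi_integral (csqrt w)" by (rule chi_sums_Xi_integral)
    hence "summable (\<lambda>s. chi s * w ^ s)" by (simp add: power_mult sums_iff)
    thus ?thesis unfolding G_def by (rule summable_sums)
  qed
  have "G holomorphic_on ball 0 r" for r
    by (rule power_series_holomorphic[where a = chi]) (use G in simp)
  hence "G field_differentiable (at w)" for w
    by (rule holomorphic_on_imp_differentiable_at[where s = "ball 0 (norm w + 1)"]) auto
  hence "G holomorphic_on UNIV" by (simp add: holomorphic_on_def)
  hence "(G \<circ> (\<lambda>z. z\<^sup>2)) holomorphic_on UNIV"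
    by (intro holomorphic_on_compose_gen[where t = UNIV]) (auto intro!: holomorphic_intros)
  moreover have "G (z\<^sup>2) = Xi_integral z" for z
    using G[of "z\<^sup>2"] chi_sums_Xi_integral(1)[of z] by (simp add: power_mult sums_iff)
  ultimately show ?thesis by (simp add: o_def)
qed

section \<open>Identification of \<open>H_tau\<close> and \<open>xi_tau\<close>\<close>

lemma Xi_integral_eq_Mellin:
  assumes x: "Re x > 13 / 2"
  shows "Xi_integral (x - 6) = integral {0<..} (\<lambda>t. L (\<i> * of_real t) * of_real t powr (x - 1))"
proof -
  define F where "F = (\<lambda>y t. L (\<i> * of_real t) * complex_of_real t powr (y - 1))"
  have fold: "F x absolutely_integrable_on {0<..1}" "F (12 - x) absolutely_integrable_on {0<..1}"
    "integral {0<..} (F x) = integral {0<..1} (F x) + integral {0<..1} (F (12 - x))"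
    unfolding F_def by (rule Mellin_transform_L_fold[OF x])+
  have "integral {0<..} (F x) = integral {0<..1} (F x) + integral {0<..1} (F (12 - x))" by (rule fold(3))
  also have "\<dots> = integral {0<..1} (\<lambda>t. F x t + F (12 - x) t)"
    by (intro Henstock_Kurzweil_Integration.integral_add[symmetric] set_lebesgue_integral_eq_integral(1) fold)
  also have "\<dots> = Xi_integral (x - 6)" unfolding Xi_integral_def
  proof (rule Henstock_Kurzweil_Integration.integral_cong)
    fix t :: real assume "t \<in> {0<..1}"
    hence t: "t > 0" by simp
    \<comment> \<open>The exponents \<open>x - 1\<close> and \<open>12 - x - 1\<close> are 5 plus
      and minus \<open>x - 6\<close>: the reflection of x to 12 - x has centre 6.\<close>
    have "complex_of_real t powr (5 + y) = of_real (t ^ 5) * exp (y * of_real (ln t))" for y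
    proof -
      have "complex_of_real t powr (5 + y) = of_real t powr 5 * of_real t powr y" by (rule powr_add)
      thus ?thesis using t by (simp add: powr_def[of _ y] Ln_of_real)
    qed
    from this[of "x - 6"] this[of "- (x - 6)"]
    show "F x t + F (12 - x) t = Xi_integrand (x - 6) t"
      by (simp add: F_def Xi_integrand_def algebra_simps)
  qed
  finally show ?thesis by (simp add: F_def)
qed

text \<open>The right-hand side is a product of entire functions and equals the Dirichlet series
  beyond 13/2 by the Mellin transform. By the identity theorem it is the only such function, so the
  definite description in \<open>H_tau\<close> denotes it.\<close>

lemma H_tau_eq: "H_tau x = of_real (2 * pi) powr x * rGamma x * Xi_integral (x - 6)"
proof -
  define h where "h x = of_real (2 * pi) powr x * rGamma x * Xi_integral (x - 6)" for x
  define P where "P h \<longleftrightarrow> h holomorphic_on UNIV \<and> (\<forall>x. Re x > 13/2 \<longrightarrow>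
        (\<lambda>l. ramanujan_tau (Suc l) * of_nat (Suc l) powr (- x)) sums h x)" for h
  have "(Xi_integral \<circ> (\<lambda>x. x - 6)) holomorphic_on UNIV"
    by (rule holomorphic_on_compose_gen[OF _ Xi_integral_holomorphic]) (auto intro!: holomorphic_intros)
  hence hol: "(\<lambda>x. Xi_integral (x - 6)) holomorphic_on UNIV" by (simp add: o_def)
  have "P h" unfolding P_def
  proof (intro conjI allI impI)
    show "h holomorphic_on UNIV" unfolding h_def by (intro holomorphic_intros hol)
    fix x assume x: "Re x > 13 / 2"
    show "(\<lambda>l. ramanujan_tau (Suc l) * of_nat (Suc l) powr (- x)) sums h x"
      unfolding h_def Xi_integral_eq_Mellin[OF x] by (rule Mellin_transform_L(2)[OF x])
  qed
  moreover have "g = h" if "P g" for g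
  proof
    fix x
    show "g x = h x"
    proof (rule analytic_continuation_open[where f = g and g = h and s = "{x. Re x > 13 / 2}" and s' = UNIV])
      show "open {x. Re x > 13 / 2}" by (rule open_halfspace_Re_gt)
      have "of_real 7 \<in> {x. Re x > 13 / 2}" by simp
      thus "{x. Re x > 13 / 2} \<noteq> {}" by blast
      show "g w = h w" if "w \<in> {x. Re x > 13 / 2}" for w
        using \<open>P g\<close> \<open>P h\<close> that sums_unique2 unfolding P_def by blast
    qed (use \<open>P g\<close> \<open>P h\<close> in \<open>auto simp: P_def\<close>)
  qed
  ultimately have "(THE h. P h) = h" by (rule the_equality)
  thus ?thesis by (simp add: H_tau_def P_def h_def)
qed

text \<open>The poles of Gamma are isolated: distinct integers are at distance at least 1.\<close>

lemma eventually_not_nonpos_Ints: "eventually (\<lambda>w. w \<notin> \<int>\<^sub>\<le>\<^sub>0) (at (x :: complex))"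
proof (cases "x \<in> \<int>\<^sub>\<le>\<^sub>0")
  case False
  then obtain d where "d > 0" "\<And>t. t \<in> ball x d \<Longrightarrow> t \<notin> \<int>\<^sub>\<le>\<^sub>0" by (rule no_nonpos_Int_in_ball') blast
  thus ?thesis unfolding eventually_at by (metis dist_commute mem_ball)
next
  case True
  then obtain n :: int where n: "x = of_int n" by (auto elim: nonpos_Ints_cases)
  have "w \<notin> \<int>\<^sub>\<le>\<^sub>0" if w: "w \<noteq> x" "dist w x < 1" for w
  proof
    assume "w \<in> \<int>\<^sub>\<le>\<^sub>0"
    then obtain m :: int where m: "w = of_int m" by (auto elim: nonpos_Ints_cases)
    have "dist w x = \<bar>of_int (m - n)\<bar>" unfolding dist_norm m n of_int_diff[symmetric] by (rule norm_of_int)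
    with w(2) have "m = n" by linarith
    with w(1) show False by (simp add: m n)
  qed
  thus ?thesis unfolding eventually_at by (intro exI[of _ 1]) auto
qed

text \<open>Near every point, the point itself excepted, \<open>rGamma w * Gamma w = 1\<close> and
  the product in \<open>xi_tau\<close> collapses to the entire function. \<open>remove_sings\<close>
  takes the limit, which continuity identifies at the poles of Gamma as well.\<close>

lemma xi_tau_eq: "xi_tau x = Xi_integral (x - 6)"
proof -
  have "isCont (\<lambda>x. Xi_integral (x - 6)) x"
  proof -
    have "isCont (\<lambda>x. x - 6) x" by (intro continuous_intros)
    moreover have "isCont Xi_integral (x - 6)"
      using holomorphic_on_imp_continuous_on[OF Xi_integral_holomorphic] by (simp add: continuous_on_eq_continuous_at)
    ultimately show ?thesis by (rule isCont_o2)
  qed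
  hence lim: "(\<lambda>x. Xi_integral (x - 6)) \<midarrow>x\<rightarrow> Xi_integral (x - 6)" by (rule isContD)
  have "eventually (\<lambda>w. Xi_integral (w - 6) = of_real (2 * pi) powr (- w) * Gamma w * H_tau w) (at x)"
    using eventually_not_nonpos_Ints
  proof eventually_elim
    case (elim w)
    hence "rGamma w * Gamma w = 1" by (simp add: rGamma_inverse_Gamma Gamma_eq_zero_iff)
    moreover have "of_real (2 * pi) powr w * of_real (2 * pi) powr (- w) = (1 :: complex)"
      by (simp add: powr_minus)
    moreover have "of_real (2 * pi) powr (- w) * Gamma w * H_tau w =
       (of_real (2 * pi) powr w * of_real (2 * pi) powr (- w)) * (rGamma w * Gamma w) * Xi_integral (w - 6)"
      unfolding H_tau_eq by (simp only: mult_ac)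
    ultimately show ?case by simp
  qed
  from Lim_transform_eventually[OF lim this] show ?thesis
    unfolding xi_tau_def by (rule remove_sings_eqI)
qed

theorem corollary1:
  fixes z :: complex
  shows "(\<lambda>s. chi s * z ^ (2 * s)) sums X z"
  using chi_sums_Xi_integral(1)[of z] by (simp add: X_def xi_tau_eq)

end
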